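(* Consider a discrete memoryless channel with noiseless, delay-free, infinite-capacity feedback, and let $R$ be a rate below capacity. For every $\gamma\ge0$ and $K\in\mathbb N$, $$\mathcal{E}_{\mathrm{AFLF}}(R,\gamma,K)\ \le\ \min\left\{\mathcal{E}_{\mathrm{ee}}(R,\gamma),\ K\,E_{\mathrm H}\!\left(\frac RK\right)\right\}.$$
   Context: Channel: finite input alphabet $\mathcal X$, finite output alphabet $\mathcal Y$, transition law $P_{Y|X}$, with $P(Y_n=y_n\mid X_1^n=x_1^n,Y_1^{n-1}=y_1^{n-1})=P_{Y|X}(y_n|x_n)$ for all $n$. The transmitter observes $Y_1,\dots,Y_{n-1}$ before sending $X_n$. All logarithms are base 2. Haroutunian exponent: $E_{\mathrm H}(R)=\min_{V:\,C(V)\le R}\max_{Q}\sum_xQ(x)D(V(\cdot|x)\|P_{Y|X}(\cdot|x))$, where $V$ ranges over channels from $\mathcal X$ to $\mathcal Y$ with capacity $C(V)\le R$, $Q$ over distributions on $\mathcal X$, and $D$ is the Kullback–Leibler divergence. It is known (Haroutunian) that $E_{\mathrm H}(R)$ upper bounds the best error exponent at rate $R$ of fixed-length block codes with feedback. AFLF code: for $\ell,M,K\in\mathbb N$, $\gamma\ge0$, $\epsilon\in(0,1)$, an $(\ell,M,\gamma,K,\epsilon)$ almost-fixed-length feedback (AFLF) code consists of (i) common randomness $U\sim P_U$ on a set $\mathcal U$, known to encoder and decoder before transmission; (ii) encoders $f_n:\mathcal U\times\{1,\dots,M\}\times\mathcal Y^{n-1}\to\mathcal X$, $n\in\mathbb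 N$, with $X_n=f_n(U,W,Y^{n-1})$, where the message $W$ is uniform on $\{1,\dots,M\}$; (iii) decoders $g_n:\mathcal U\times\mathcal Y^n\to\{1,\dots,M\}$, $n\in\mathbb N$; (iv) a random stopping time $\tau\in\mathbb N$ (determined by $U$ and the channel outputs observed so far) with $P(\tau>\ell)\le2^{-\gamma\ell}$ and $\tau\le K\ell$ almost surely, such that $\hat W_\tau:=g_\tau(U,Y^\tau)$ satisfies $P(\hat W_\tau\ne W)\le\epsilon$. $(R,E)$ is achievable in a $(\gamma,K)$-almost-fixed-length manner with feedback if for every $\delta>0$ there is $\ell(\delta)\in\mathbb N$ such that for all $\ell\ge\ell(\delta)$ there is an $(\ell,M_\ell,\gamma,K,\epsilon_\ell)$ AFLF code with $M_\ell\ge2^{\ell R}$ and $\epsilon_\ell\le2^{-\ell(E-\delta)}$. $\mathcal{E}_{\mathrm{AFLF}}(R,\gamma,K)$ is the largest (supremum) such $E$. Error-erasure code: for $\epsilon,\epsilon_{\mathbf x}\in(0,1)$, an $(\ell,M,\epsilon,\epsilon_{\mathbf x})$ fixed-length error-erasure feedback code has common randomness and encoders as in (i), (ii), decoders $g_n:\mathcal U\times\mathcal Y^n\to\{1,\dots,M\}\cup\{e\}$ where $e$ denotes an erasure, stopping time $\tau=\ell$ a.s., and final estimate $\hat W_\ell=g_\ell(U,Y^\ell)$ satisfying $P(\hat W_\ell\ne W)-P(\hat W_\ell=e)\le\epsilon$ and $P(\hat W_\ell=e)\le\epsilon_{\mathbf x}$. A triple $(R,E,E_{\mathbf x})$ is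 achievable in a fixed-length manner with feedback and error-erasure decoding if for every $\delta>0$ there is $\ell(\delta)$ such that for all $\ell\ge\ell(\delta)$ there is an $(\ell,M_\ell,\epsilon_\ell,\epsilon_{\ell,\mathbf x})$ fixed-length error-erasure feedback code with $M_\ell\ge2^{\ell R}$, $\epsilon_\ell\le2^{-\ell(E-\delta)}$, $\epsilon_{\ell,\mathbf x}\le2^{-\ell(E_{\mathbf x}-\delta)}$. $\mathcal E_{\mathrm{ee}}(R,E_{\mathbf x})$ is the largest (supremum, in $[0,\infty]$) $E$ such that $(R,E,E_{\mathbf x})$ is achievable.
   Formalization: The bound by K E_H(R/K) is claimed only when R/K is not the infimum of rates where E_H is finite; at that rate it can fail (R=0 with M=1, or a noisy typewriter at R=1). Common randomness takes real values, which loses nothing. *)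

theory Defs
  imports "HOL-Probability.Probability"
begin

section \<open>Information measures\<close>

text \<open>The library's \<open>KL_divergence\<close> is real-valued and only meaningful under absolute
  continuity; outside of it the divergence is \<open>\<infinity>\<close>.\<close>

definition divergence :: "'y pmf \<Rightarrow> 'y pmf \<Rightarrow> ereal" where
  "divergence V P =
     (if absolutely_continuous (measure_pmf P) (measure_pmf V)
      then ereal (KL_divergence 2 (measure_pmf P) (measure_pmf V)) else \<infinity>)"

definition channel_information :: "'x pmf \<Rightarrow> ('x \<Rightarrow> 'y pmf) \<Rightarrow> real" where
  "channel_information Q V =
     prob_space.mutual_information (measure_pmf (bind_pmf Q (\<lambda>x. map_pmf (Pair x) (V x))))
       2 (count_space UNIV) (count_space UNIV) fst snd"

definition capacity :: "('x::finite \<Rightarrow> 'y::finite pmf) \<Rightarrow> real" where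
  "capacity V = (SUP Q. channel_information Q V)"

text \<open>The extended-real \<open>INF\<close> and \<open>SUP\<close> are the minimum and the maximum whenever the
  constraint set is nonempty (\<open>R \<ge> 0\<close>); note that \<open>0 * \<infinity> = 0\<close> in \<^typ>\<open>ereal\<close>.\<close>

definition haroutunian_exponent :: "('x::finite \<Rightarrow> 'y::finite pmf) \<Rightarrow> real \<Rightarrow> ereal" where
  "haroutunian_exponent P R =
     (INF V \<in> {V. capacity V \<le> R}. SUP Q. \<Sum>x\<in>UNIV. ereal (pmf Q x) * divergence (V x) (P x))"

text \<open>At this single rate the Haroutunian exponent need not bound the error exponent: on a
  four-input noisy typewriter channel with crossover probability other than \<open>1/2\<close> it is finite
  at rate 1, although zero-error codes of that rate exist; at rate 0 one-message codes never
  err.\<close>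

definition finiteness_rate :: "('x::finite \<Rightarrow> 'y::finite pmf) \<Rightarrow> real" where
  "finiteness_rate P = Inf {R. haroutunian_exponent P R < \<infinity>}"


section \<open>Transmission with feedback\<close>

text \<open>The index \<open>n\<close> of an encoder \<open>f\<^sub>n\<close> or decoder \<open>g\<^sub>n\<close> is carried by the length of
  its list argument: \<open>f ys\<close> is the input sent after the outputs \<open>ys\<close> have been observed
  (oldest first).\<close>

primrec channel_outputs :: "('x \<Rightarrow> 'y pmf) \<Rightarrow> ('y list \<Rightarrow> 'x) \<Rightarrow> nat \<Rightarrow> 'y list pmf" where
  "channel_outputs P f 0 = return_pmf []"
| "channel_outputs P f (Suc n) =
     bind_pmf (channel_outputs P f n) (\<lambda>ys. map_pmf (\<lambda>y. ys @ [y]) (P (f ys)))"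

text \<open>Conditional joint law of the message and the first \<open>n\<close> outputs, given the value of the
  common randomness.\<close>

definition transmission ::
    "('x \<Rightarrow> 'y pmf) \<Rightarrow> nat \<Rightarrow> (nat \<Rightarrow> 'y list \<Rightarrow> 'x) \<Rightarrow> nat \<Rightarrow> (nat \<times> 'y list) pmf" where
  "transmission P M f n =
     bind_pmf (pmf_of_set {1..M}) (\<lambda>w. map_pmf (Pair w) (channel_outputs P (f w) n))"

text \<open>The common randomness is an arbitrary probability space whose underlying set consists of
  real numbers (the \<open>\<sigma>\<close>-algebra need not be the Borel one), so that every set of at most
  continuum size is covered. \<open>code_prob U P M f n A\<close> is the probability of the event \<open>A\<close> in terms
  of the common randomness \<open>u\<close>, the message \<open>w\<close> and the first \<open>n\<close> outputs.\<close>

definition code_prob ::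
    "real measure \<Rightarrow> ('x \<Rightarrow> 'y pmf) \<Rightarrow> nat \<Rightarrow> (real \<Rightarrow> nat \<Rightarrow> 'y list \<Rightarrow> 'x) \<Rightarrow> nat
      \<Rightarrow> (real \<Rightarrow> nat \<Rightarrow> 'y list \<Rightarrow> bool) \<Rightarrow> real" where
  "code_prob U P M f n A =
     (\<integral>u. measure_pmf.prob (transmission P M (f u) n) {(w, ys). A u w ys} \<partial>U)"

definition feedback_encoder ::
    "real measure \<Rightarrow> nat \<Rightarrow> (real \<Rightarrow> nat \<Rightarrow> 'y list \<Rightarrow> 'x) \<Rightarrow> bool" where
  "feedback_encoder U M f \<longleftrightarrow>
     (\<forall>w\<in>{1..M}. \<forall>ys. (\<lambda>u. f u w ys) \<in> U \<rightarrow>\<^sub>M count_space UNIV)"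

definition feedback_decoder ::
    "real measure \<Rightarrow> 'd set \<Rightarrow> (real \<Rightarrow> 'y list \<Rightarrow> 'd) \<Rightarrow> bool" where
  "feedback_decoder U D g \<longleftrightarrow> (\<forall>ys. (\<lambda>u. g u ys) \<in> U \<rightarrow>\<^sub>M count_space D)"


section \<open>Almost-fixed-length codes\<close>

text \<open>A stopping time \<open>\<tau>\<close> of the filtration generated by \<open>U, Y\<^sub>1, Y\<^sub>2, \<dots>\<close> is given by its
  events \<open>{\<tau> = n}\<close>, each a predicate of \<open>u\<close> and the first \<open>n\<close> outputs; with \<open>stop u\<close>
  as this predicate, \<open>\<tau>\<close> is the first \<open>n \<ge> 1\<close> at which it holds. The value \<open>\<infinity>\<close> means
  that \<open>\<tau>\<close> exceeds the number of outputs in the list.\<close>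

definition halting_time :: "('y list \<Rightarrow> bool) \<Rightarrow> 'y list \<Rightarrow> enat" where
  "halting_time stop ys = (INF n \<in> {n \<in> {1..length ys}. stop (take n ys)}. enat n)"

text \<open>Since \<open>\<tau> \<le> K * l\<close> almost surely, the first \<open>K * l\<close> outputs determine all events
  that occur here.\<close>

definition aflf_code ::
    "('x::finite \<Rightarrow> 'y::finite pmf) \<Rightarrow> nat \<Rightarrow> nat \<Rightarrow> real \<Rightarrow> nat \<Rightarrow> real \<Rightarrow> real measure
      \<Rightarrow> (real \<Rightarrow> nat \<Rightarrow> 'y list \<Rightarrow> 'x) \<Rightarrow> (real \<Rightarrow> 'y list \<Rightarrow> nat) \<Rightarrow> (real \<Rightarrow> 'y list \<Rightarrow> bool)
      \<Rightarrow> bool" where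
  "aflf_code P l M \<gamma> K \<epsilon> U f g stop \<longleftrightarrow>
     1 \<le> l \<and> 1 \<le> M \<and> 1 \<le> K \<and> 0 \<le> \<gamma> \<and> 0 < \<epsilon> \<and> \<epsilon> < 1 \<and>
     prob_space U \<and> feedback_encoder U M f \<and> feedback_decoder U {1..M} g \<and>
     (\<forall>ys. (\<lambda>u. stop u ys) \<in> U \<rightarrow>\<^sub>M count_space UNIV) \<and>
     code_prob U P M f (K * l) (\<lambda>u w ys. halting_time (stop u) ys > enat l)
       \<le> 2 powr (- (\<gamma> * real l)) \<and>
     code_prob U P M f (K * l) (\<lambda>u w ys. halting_time (stop u) ys \<le> enat (K * l)) = 1 \<and>
     code_prob U P M f (K * l)
         (\<lambda>u w ys. g u (take (the_enat (halting_time (stop u) ys)) ys) \<noteq> w) \<le> \<epsilon>"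

definition aflf_achievable ::
    "('x::finite \<Rightarrow> 'y::finite pmf) \<Rightarrow> real \<Rightarrow> real \<Rightarrow> nat \<Rightarrow> real \<Rightarrow> bool" where
  "aflf_achievable P R \<gamma> K E \<longleftrightarrow>
     (\<forall>\<delta>>0. \<exists>l0. \<forall>l\<ge>l0. \<exists>M \<epsilon> U f g stop.
        aflf_code P l M \<gamma> K \<epsilon> U f g stop \<and>
        real M \<ge> 2 powr (real l * R) \<and> \<epsilon> \<le> 2 powr (- (real l * (E - \<delta>))))"

definition aflf_exponent :: "('x::finite \<Rightarrow> 'y::finite pmf) \<Rightarrow> real \<Rightarrow> real \<Rightarrow> nat \<Rightarrow> ereal" where
  "aflf_exponent P R \<gamma> K = (SUP E \<in> {E. 0 \<le> E \<and> aflf_achievable P R \<gamma> K E}. ereal E)"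


section \<open>Fixed-length codes with error-erasure decoding\<close>

text \<open>\<^const>\<open>None\<close> is the erasure symbol.\<close>

definition ee_code ::
    "('x::finite \<Rightarrow> 'y::finite pmf) \<Rightarrow> nat \<Rightarrow> nat \<Rightarrow> real \<Rightarrow> real \<Rightarrow> real measure
      \<Rightarrow> (real \<Rightarrow> nat \<Rightarrow> 'y list \<Rightarrow> 'x) \<Rightarrow> (real \<Rightarrow> 'y list \<Rightarrow> nat option) \<Rightarrow> bool" where
  "ee_code P l M \<epsilon> \<epsilon>\<^sub>x U f g \<longleftrightarrow>
     1 \<le> l \<and> 1 \<le> M \<and> 0 < \<epsilon> \<and> \<epsilon> < 1 \<and> 0 < \<epsilon>\<^sub>x \<and> \<epsilon>\<^sub>x < 1 \<and>
     prob_space U \<and> feedback_encoder U M f \<and>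
     feedback_decoder U (insert None (Some ` {1..M})) g \<and>
     code_prob U P M f l (\<lambda>u w ys. g u ys \<noteq> Some w)
       - code_prob U P M f l (\<lambda>u w ys. g u ys = None) \<le> \<epsilon> \<and>
     code_prob U P M f l (\<lambda>u w ys. g u ys = None) \<le> \<epsilon>\<^sub>x"

definition ee_achievable ::
    "('x::finite \<Rightarrow> 'y::finite pmf) \<Rightarrow> real \<Rightarrow> real \<Rightarrow> real \<Rightarrow> bool" where
  "ee_achievable P R E E\<^sub>x \<longleftrightarrow>
     (\<forall>\<delta>>0. \<exists>l0. \<forall>l\<ge>l0. \<exists>M \<epsilon> \<epsilon>\<^sub>x U f g.
        ee_code P l M \<epsilon> \<epsilon>\<^sub>x U f g \<and>
        real M \<ge> 2 powr (real l * R) \<and>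
        \<epsilon> \<le> 2 powr (- (real l * (E - \<delta>))) \<and> \<epsilon>\<^sub>x \<le> 2 powr (- (real l * (E\<^sub>x - \<delta>))))"

definition ee_exponent :: "('x::finite \<Rightarrow> 'y::finite pmf) \<Rightarrow> real \<Rightarrow> real \<Rightarrow> ereal" where
  "ee_exponent P R E\<^sub>x = (SUP E \<in> {E. 0 \<le> E \<and> ee_achievable P R E E\<^sub>x}. ereal E)"

end

theory Submission
  imports Defs
begin

text \<open>Erasing whenever the stopping time exceeds \<open>l\<close> turns an AFLF code into an error-erasure code.
  On the other hand, an AFLF code is a block code with feedback of length \<open>K * l\<close>, so Haroutunian's
  bound applies. For an auxiliary channel \<open>V\<close> of capacity below the rate, a likelihood ratio bound
  against an output distribution \<open>q\<close> with \<open>D(V(\<cdot>|x) || q)\<close> at most about the capacity for all \<open>x\<close>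
  shows that decoding fails under \<open>V\<close> with probability tending to one, and a second one against \<open>P\<close>
  transfers this failure to \<open>P\<close> at the cost of the factor \<open>2 powr (- n D)\<close>. Feedback does no harm,
  since both likelihood ratios are controlled letter by letter, whatever input was chosen.\<close>

section \<open>Divergence and capacity\<close>

text \<open>The likelihood ratio bound forces errors only when the number of messages exceeds the
  capacity term by a linear margin in the exponent, whereas the minimum defining the exponent admits
  channels of capacity exactly \<open>R / K\<close>. The margin comes from a second channel of
  strictly smaller capacity whose divergence from \<open>P\<close> is finite. If the exponent is
  finite at \<open>R / K\<close>, such a channel exists precisely when \<open>R / K\<close> differs
  from the finiteness rate, which is why the theorem sets that rate apart. With feedback the
  log-likelihood ratio is not a sum of independent terms. A Chernoff bound still works: the
  conditional moment of each new factor is bounded uniformly over the past, so these bounds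
  multiply. The comparison with error-erasure codes has a boundary case. For
  \<open>\<gamma> = 0\<close> the bound on late stopping is 1, which is not an admissible erasure
  probability, so that case needs an argument of its own.\<close>

definition kl :: "'y::finite pmf \<Rightarrow> 'y pmf \<Rightarrow> real" where
  "kl p q = (\<Sum>y\<in>UNIV. pmf p y * ln (pmf p y / pmf q y))"

lemma kl_self [simp]: "kl p p = 0"
  unfolding kl_def by (rule sum.neutral) simp

text \<open>\<open>kl\<close> is measured in nats, hence the factor \<open>ln 2\<close>. By the
  conventions for division by zero and \<open>ln 0\<close>, its summands vanish where
  \<open>q\<close> does, so it is the divergence only under containment of supports; the value
  \<infinity> is decided here.\<close>

lemma divergence_eq_kl:
  fixes p q :: "'y::finite pmf"
  shows "divergence p q = (if set_pmf p \<subseteq> set_pmf q then ereal (kl p q / ln 2) else \<infinity>)"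
proof -
  have ac: "absolutely_continuous (measure_pmf q) (measure_pmf p) \<longleftrightarrow> set_pmf p \<subseteq> set_pmf q"
    unfolding absolutely_continuous_def null_sets_def
    by (auto simp: measure_pmf.emeasure_eq_measure measure_pmf_zero_iff)
  have "KL_divergence 2 (measure_pmf q) (measure_pmf p) = kl p q / ln 2" if "set_pmf p \<subseteq> set_pmf q"
  proof -
    interpret sigma_finite_measure "count_space (UNIV :: 'y set)"
      by (simp add: sigma_finite_measure_count_space_finite)
    have "KL_divergence 2 (density (count_space UNIV) (pmf q)) (density (count_space UNIV) (pmf p)) =
        (\<integral>y. pmf p y * log 2 (pmf p y / pmf q y) \<partial>count_space UNIV)"
      using that by (intro KL_density_density) (auto simp: AE_count_space set_pmf_eq)
    also have "\<dots> = kl p q / ln 2"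
      by (simp add: lebesgue_integral_count_space_finite kl_def log_def sum_divide_distrib)
    finally show ?thesis
      by (simp add: measure_pmf_eq_density)
  qed
  then show ?thesis
    by (simp add: divergence_def ac)
qed

lemma pmf_bind_finite:
  fixes Q :: "'x::finite pmf"
  shows "pmf (bind_pmf Q V) y = (\<Sum>x\<in>UNIV. pmf Q x * pmf (V x) y)"
  by (simp add: pmf_bind integral_measure_pmf_real[where A=UNIV] mult.commute)

lemma channel_information_eq_kl:
  fixes Q :: "'x::finite pmf" and V :: "'x \<Rightarrow> 'y::finite pmf"
  shows "channel_information Q V * ln 2 = (\<Sum>x\<in>UNIV. pmf Q x * kl (V x) (bind_pmf Q V))"
proof -
  define J where "J = bind_pmf Q (\<lambda>x. map_pmf (Pair x) (V x))"
  have fstJ: "map_pmf fst J = Q"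
    by (simp add: J_def map_bind_pmf pmf.map_comp o_def map_pmf_const bind_return_pmf')
  have sndJ: "map_pmf snd J = bind_pmf Q V"
    by (simp add: J_def map_bind_pmf pmf.map_comp o_def)
  have J: "pmf J (x, y) = pmf Q x * pmf (V x) y" for x y
  proof -
    have "pmf (map_pmf (Pair x') (V x')) (x, y) = (if x' = x then pmf (V x) y else 0)" for x'
      by (auto simp: pmf_map_inj' inj_on_def pmf_eq_0_set_pmf)
    then show ?thesis
      by (simp add: J_def pmf_bind_finite if_distrib[of "(*) _"] cong: if_cong)
  qed
  interpret information_space "measure_pmf J" 2
    by standard simp
  have sd: "simple_distributed (measure_pmf J) h (pmf (map_pmf h J))" if "finite (range h)" for h :: "_ \<Rightarrow> 'z"
    by (rule measure_pmf.simple_distributedI)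
      (auto simp: simple_function_def pmf.rep_eq measure_map_pmf that)
  have "channel_information Q V =
      (\<Sum>(x, y)\<in>(\<lambda>z. (fst z, snd z)) ` UNIV. pmf J (x, y) * log 2 (pmf J (x, y) / (pmf Q x * pmf (bind_pmf Q V) y)))"
    using mutual_information_simple_distributed[OF sd[of fst] sd[of snd] sd[of "\<lambda>x. (fst x, snd x)"]]
    by (simp add: channel_information_def J_def[symmetric] fstJ sndJ)
  also have "\<dots> = (\<Sum>x\<in>UNIV. \<Sum>y\<in>UNIV. pmf J (x, y) * log 2 (pmf J (x, y) / (pmf Q x * pmf (bind_pmf Q V) y)))"
    by (simp add: sum.cartesian_product UNIV_Times_UNIV)
  \<comment> \<open>Where \<open>pmf Q x\<close> is zero both summands vanish; elsewhere it cancels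
    inside the logarithm.\<close>
  also have "\<dots> = (\<Sum>x\<in>UNIV. \<Sum>y\<in>UNIV. pmf Q x * pmf (V x) y * (ln (pmf (V x) y / pmf (bind_pmf Q V) y) / ln 2))"
    by (intro sum.cong refl) (simp add: J log_def)
  finally show ?thesis
    by (simp add: kl_def sum_distrib_left sum_distrib_right mult.assoc)
qed

text \<open>Losing a factor \<open>a\<close> in the reference law costs \<open>ln (1 / a)\<close>.
  This serves twice: with \<open>a = pmf Q x\<close> to bound the information, and with
  \<open>a = 1 - t\<close> to pass to a mixture.\<close>

lemma kl_le_of_dominated:
  fixes p q r :: "'y::finite pmf"
  assumes "0 < a" and dom: "\<And>y. y \<in> set_pmf p \<Longrightarrow> 0 < pmf q y \<and> a * pmf q y \<le> pmf r y"
  shows "kl p r \<le> kl p q + ln (1 / a)"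
proof -
  have "kl p r \<le> (\<Sum>y\<in>UNIV. pmf p y * ln (pmf p y / pmf q y) + pmf p y * ln (1 / a))"
    unfolding kl_def
  proof (rule sum_mono)
    fix y
    show "pmf p y * ln (pmf p y / pmf r y) \<le> pmf p y * ln (pmf p y / pmf q y) + pmf p y * ln (1 / a)"
    proof (cases "y \<in> set_pmf p")
      case True
      then have p: "0 < pmf p y" by (simp add: pmf_positive)
      have q: "0 < pmf q y" "a * pmf q y \<le> pmf r y" using dom[OF True] by auto
      have r: "0 < pmf r y"
        using q \<open>0 < a\<close> by (meson less_le_trans mult_pos_pos)
      have "ln (pmf p y / pmf r y) \<le> ln (pmf p y / (a * pmf q y))"
        using p q r \<open>0 < a\<close> by (intro ln_mono) (auto intro!: divide_left_mono)
      also have "\<dots> = ln (pmf p y / pmf q y) + ln (1 / a)"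
        using p q \<open>0 < a\<close> by (simp add: ln_div ln_mult)
      finally show ?thesis
        using p by (simp add: distrib_left[symmetric])
    qed (simp add: set_pmf_eq)
  qed
  also have "\<dots> = kl p q + ln (1 / a)"
    by (simp add: kl_def sum.distrib sum_distrib_right[symmetric] sum_pmf_eq_1)
  finally show ?thesis .
qed

text \<open>Gibbs' inequality: the two sides differ by the divergence of the true output law from
  \<open>r\<close>. Supports are compared only for inputs that \<open>Q\<close> uses.\<close>

lemma sum_kl_output_le:
  fixes Q :: "'x::finite pmf" and V :: "'x \<Rightarrow> 'y::finite pmf"
  assumes "\<And>x. x \<in> set_pmf Q \<Longrightarrow> set_pmf (V x) \<subseteq> set_pmf r"
  shows "(\<Sum>x\<in>UNIV. pmf Q x * kl (V x) (bind_pmf Q V)) \<le> (\<Sum>x\<in>UNIV. pmf Q x * kl (V x) r)"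
proof -
  define q where "q = bind_pmf Q V"
  have *: "pmf Q x * (pmf (V x) y * ln (pmf (V x) y / pmf q y)) - pmf Q x * (pmf (V x) y * ln (pmf (V x) y / pmf r y))
      \<le> pmf Q x * pmf (V x) y * (pmf r y / pmf q y - 1)" for x y
  proof (cases "x \<in> set_pmf Q \<and> y \<in> set_pmf (V x)")
    case True
    then have pos: "0 < pmf Q x" "0 < pmf (V x) y" "0 < pmf r y" "0 < pmf q y"
      using assms by (auto simp: pmf_positive_iff q_def)
    then have "ln (pmf (V x) y / pmf q y) - ln (pmf (V x) y / pmf r y) = ln (pmf r y / pmf q y)"
      by (simp add: ln_div)
    also have "\<dots> \<le> pmf r y / pmf q y - 1"
      using pos by (intro ln_le_minus_one) simp
    finally have "pmf Q x * pmf (V x) y * (ln (pmf (V x) y / pmf q y) - ln (pmf (V x) y / pmf r y))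
        \<le> pmf Q x * pmf (V x) y * (pmf r y / pmf q y - 1)"
      using pos by (intro mult_left_mono) auto
    then show ?thesis
      by (simp add: algebra_simps)
  qed (auto simp: set_pmf_eq)
  have "(\<Sum>x\<in>UNIV. pmf Q x * kl (V x) q) - (\<Sum>x\<in>UNIV. pmf Q x * kl (V x) r)
      \<le> (\<Sum>x\<in>UNIV. \<Sum>y\<in>UNIV. pmf Q x * pmf (V x) y * (pmf r y / pmf q y - 1))"
    unfolding kl_def sum_distrib_left sum_subtractf[symmetric] by (intro sum_mono *)
  also have "\<dots> = (\<Sum>y\<in>UNIV. pmf q y * (pmf r y / pmf q y - 1))"
    by (subst sum.swap) (simp add: sum_distrib_right q_def pmf_bind_finite)
  \<comment> \<open>Only an inequality: where \<open>q\<close> vanishes the left summand is 0 and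
    the right one is \<open>pmf r y\<close>.\<close>
  also have "\<dots> \<le> (\<Sum>y\<in>UNIV. pmf r y - pmf q y)"
    by (intro sum_mono) (simp add: field_simps)
  also have "\<dots> = 0"
    by (simp add: sum_subtractf sum_pmf_eq_1)
  finally show ?thesis
    by (simp add: q_def)
qed

lemma kl_nonneg:
  fixes p r :: "'y::finite pmf"
  assumes "set_pmf p \<subseteq> set_pmf r"
  shows "0 \<le> kl p r"
proof -
  show ?thesis
    using sum_kl_output_le[of "return_pmf ()" "\<lambda>_. p" r] assms
    by (simp add: bind_return_pmf UNIV_unit)
qed

lemma channel_information_nonneg:
  fixes Q :: "'x::finite pmf" and V :: "'x \<Rightarrow> 'y::finite pmf"
  shows "0 \<le> channel_information Q V"
proof -
  have "0 \<le> (\<Sum>x\<in>UNIV. pmf Q x * kl (V x) (bind_pmf Q V))"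
  proof (rule sum_nonneg)
    fix x
    show "0 \<le> pmf Q x * kl (V x) (bind_pmf Q V)"
      by (cases "x \<in> set_pmf Q") (auto simp: set_pmf_eq[of Q] intro!: mult_nonneg_nonneg kl_nonneg)
  qed
  then have "0 \<le> channel_information Q V * ln 2"
    by (simp add: channel_information_eq_kl)
  then show ?thesis
    by (simp add: zero_le_mult_iff)
qed

text \<open>A supremum of reals means something only over a bounded set. The output law dominates
  \<open>pmf Q x\<close> times \<open>V x\<close>, so each input contributes at most
  \<open>pmf Q x * ln (1 / pmf Q x)\<close>, which is at most 1.\<close>

lemma bdd_above_channel_information:
  fixes V :: "'x::finite \<Rightarrow> 'y::finite pmf"
  shows "bdd_above (range (\<lambda>Q. channel_information Q V))"
proof (rule bdd_aboveI2)
  fix Q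
  have "pmf Q x * kl (V x) (bind_pmf Q V) \<le> 1" for x
  proof (cases "x \<in> set_pmf Q")
    case True
    then have Q: "0 < pmf Q x" by (simp add: pmf_positive)
    have "kl (V x) (bind_pmf Q V) \<le> kl (V x) (V x) + ln (1 / pmf Q x)"
      by (rule kl_le_of_dominated[OF Q])
        (auto simp: pmf_bind_finite pmf_positive intro!: member_le_sum[of x _ "\<lambda>x. pmf Q x * pmf (V x) _"])
    also have "\<dots> = ln (1 / pmf Q x)"
      by simp
    also have "\<dots> \<le> 1 / pmf Q x - 1"
      using Q by (intro ln_le_minus_one) simp
    finally show ?thesis
      using Q mult_left_mono[of "kl (V x) (bind_pmf Q V)" "1 / pmf Q x - 1" "pmf Q x"]
      by (simp add: algebra_simps)
  qed (simp add: set_pmf_eq)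
  then have "channel_information Q V * ln 2 \<le> real CARD('x)"
    unfolding channel_information_eq_kl using sum_mono[of UNIV _ "\<lambda>_. 1::real"] by fastforce
  then show "channel_information Q V \<le> real CARD('x) / ln 2"
    by (simp add: field_simps)
qed

lemma channel_information_le_capacity: "channel_information Q V \<le> capacity V"
  unfolding capacity_def by (rule cSUP_upper[OF _ bdd_above_channel_information]) simp

lemma capacity_nonneg: "0 \<le> capacity V"
  using channel_information_nonneg channel_information_le_capacity order_trans by blast

lemma pmf_bind_bernoulli:
  assumes "0 \<le> s" "s \<le> 1"
  shows "pmf (bind_pmf (bernoulli_pmf s) (\<lambda>b. if b then p else q)) y = s * pmf p y + (1 - s) * pmf q y"
  using assms by (simp add: pmf_bind_finite UNIV_bool)

text \<open>Moving the mass \<open>s\<close> of an input distribution to the input \<open>x\<close> raises the information by about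
  \<open>s\<close> times the difference of the divergence at \<open>x\<close> and the information. Near a maximiser there is
  no room for such a gain. Mixing a little of every output distribution \<open>V x\<close> into the output
  distribution makes one \<open>q\<close> serve all \<open>x\<close>, so no maximiser has to exist.\<close>

lemma ex_output_pmf_kl_le_capacity:
  fixes V :: "'x::finite \<Rightarrow> 'y::finite pmf"
  assumes "0 < \<eta>"
  obtains q where "\<And>x. set_pmf (V x) \<subseteq> set_pmf q" "\<And>x. kl (V x) q \<le> capacity V * ln 2 + \<eta>"
proof -
  define N where "N = real CARD('x)"
  \<comment> \<open>\<open>t\<close> makes \<open>ln (1 / (1 - t))\<close> equal to
    \<open>\<eta> / 2\<close>, half of the allowance. The weight \<open>t\<close>, spread evenly
    over the \<open>N\<close> inputs, gives each \<open>V x\<close> the weight \<open>s\<close>;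
    hence the mixture \<open>q'\<close> below dominates \<open>1 - t\<close> times the perturbed
    output law of every \<open>x\<close> at once.\<close>
  define t where "t = 1 - exp (- \<eta> / 2)"
  define s where "s = t / N"
  have N: "1 \<le> N"
    by (simp add: N_def Suc_le_eq)
  have t: "0 < t" "t < 1" using assms by (auto simp: t_def)
  have s: "0 < s" "s \<le> t" "s < 1"
    using N t frac_le[of t t 1 N] by (auto simp: s_def)
  \<comment> \<open>The shortfall of \<open>Q\<close> is later divided by the moved mass
    \<open>s\<close>, which leaves the other half of the allowance.\<close>
  have "capacity V - s * \<eta> / 2 / ln 2 < capacity V"
    using s assms by simp
  then obtain Q where "capacity V - s * \<eta> / 2 / ln 2 < channel_information Q V"
    unfolding capacity_def by (subst (asm) less_cSUP_iff) (auto simp: bdd_above_channel_information)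
  then have Q: "capacity V * ln 2 - s * \<eta> / 2 < channel_information Q V * ln 2"
    by (simp add: field_simps)
  define avg where "avg = bind_pmf (pmf_of_set UNIV) V"
  define q' where "q' = bind_pmf (bernoulli_pmf t) (\<lambda>b. if b then avg else bind_pmf Q V)"
  have q': "pmf q' y = t * pmf avg y + (1 - t) * pmf (bind_pmf Q V) y" for y
    using t by (simp add: q'_def pmf_bind_bernoulli)
  have avg: "pmf (V x) y / N \<le> pmf avg y" for x y
    unfolding avg_def pmf_bind_finite N_def
    by (auto simp: pmf_of_set intro!: member_le_sum[of x _ "\<lambda>x. pmf (V x) y / real CARD('x)", simplified])
  have sub: "set_pmf (V x) \<subseteq> set_pmf q'" for x
    using t by (auto simp: q'_def avg_def set_pmf_bernoulli intro!: exI[of _ True])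
  have kl: "kl (V x) q' \<le> capacity V * ln 2 + \<eta>" for x
  proof -
    define Qs where "Qs = bind_pmf (bernoulli_pmf s) (\<lambda>b. if b then return_pmf x else Q)"
    define qs where "qs = bind_pmf Qs V"
    have Qs: "pmf Qs x' = (if x' = x then s else 0) + (1 - s) * pmf Q x'" for x'
      using s by (simp add: Qs_def pmf_bind_bernoulli indicator_def)
    have "qs = bind_pmf (bernoulli_pmf s) (\<lambda>b. if b then V x else bind_pmf Q V)"
      by (auto simp: qs_def Qs_def bind_assoc_pmf bind_return_pmf intro!: bind_pmf_cong)
    then have qs: "pmf qs y = s * pmf (V x) y + (1 - s) * pmf (bind_pmf Q V) y" for y
      using s by (simp add: pmf_bind_bernoulli)
    have "set_pmf Q \<subseteq> set_pmf Qs"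
      using s by (auto simp: Qs_def set_pmf_bernoulli)
    then have gibbs: "(\<Sum>x\<in>UNIV. pmf Q x * kl (V x) (bind_pmf Q V)) \<le> (\<Sum>x\<in>UNIV. pmf Q x * kl (V x) qs)"
      by (intro sum_kl_output_le) (auto simp: qs_def)
    have "(1 - s) * (channel_information Q V * ln 2) + s * kl (V x) qs
        \<le> (1 - s) * (\<Sum>x\<in>UNIV. pmf Q x * kl (V x) qs) + s * kl (V x) qs"
      using gibbs s by (simp add: channel_information_eq_kl)
    also have "\<dots> = (\<Sum>x\<in>UNIV. pmf Qs x * kl (V x) qs)"
      by (simp add: Qs distrib_right sum.distrib sum_distrib_left mult.assoc if_distrib[of "\<lambda>a. a * _"] cong: if_cong)
    also have "\<dots> = channel_information Qs V * ln 2"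
      by (simp add: channel_information_eq_kl qs_def)
    also have "\<dots> \<le> capacity V * ln 2"
      by (simp add: channel_information_le_capacity)
    finally have "(1 - s) * (channel_information Q V * ln 2) + s * kl (V x) qs \<le> capacity V * ln 2" .
    moreover have "(1 - s) * (capacity V * ln 2 - s * \<eta> / 2) \<le> (1 - s) * (channel_information Q V * ln 2)"
      using Q s by (intro mult_left_mono) auto
    ultimately have "s * kl (V x) qs \<le> s * (capacity V * ln 2 + \<eta> / 2) - s * (s * \<eta> / 2)"
      by (simp add: algebra_simps diff_divide_distrib)
    also have "\<dots> \<le> s * (capacity V * ln 2 + \<eta> / 2)"
      using s assms by simp
    finally have 1: "kl (V x) qs \<le> capacity V * ln 2 + \<eta> / 2"
      using s by simp
    have "kl (V x) q' \<le> kl (V x) qs + ln (1 / (1 - t))"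
    proof (rule kl_le_of_dominated)
      fix y assume y: "y \<in> set_pmf (V x)"
      have "0 < pmf qs y"
        unfolding qs using s y by (intro add_pos_nonneg mult_pos_pos) (auto simp: pmf_positive)
      moreover have "(1 - t) * pmf qs y \<le> pmf q' y"
      proof -
        have "(1 - t) * (s * pmf (V x) y) \<le> 1 * (s * pmf (V x) y)"
          using t s by (intro mult_right_mono) auto
        also have "\<dots> \<le> t * pmf avg y"
          using mult_left_mono[OF avg[of x y], of t] t by (simp add: s_def)
        finally have a: "(1 - t) * (s * pmf (V x) y) \<le> t * pmf avg y" .
        have b: "(1 - t) * ((1 - s) * pmf (bind_pmf Q V) y) \<le> (1 - t) * (1 * pmf (bind_pmf Q V) y)"
          using t s by (intro mult_left_mono mult_right_mono) auto
        show ?thesis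
          using a b unfolding qs q' distrib_left by linarith
      qed
      ultimately show "0 < pmf qs y \<and> (1 - t) * pmf qs y \<le> pmf q' y" ..
    qed (use t in simp)
    moreover have "ln (1 / (1 - t)) = \<eta> / 2"
      by (simp add: t_def ln_div)
    ultimately show ?thesis
      using 1 by simp
  qed
  show ?thesis
    using that[OF sub kl] .
qed

section \<open>Likelihood ratios along a feedback transmission\<close>

text \<open>The past itself is the channel input, so \<open>\<kappa>\<close> is an arbitrary
  transition kernel. This covers an encoder followed by a channel that changes with time, as well as
  product laws, which look only at the length of the past.\<close>

abbreviation feedback_law :: "('y list \<Rightarrow> 'y pmf) \<Rightarrow> nat \<Rightarrow> 'y list pmf" where
  "feedback_law \<kappa> \<equiv> channel_outputs \<kappa> (\<lambda>ys. ys)"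

lemma channel_outputs_eq_feedback_law:
  "channel_outputs P f n = feedback_law (\<lambda>ys. P (f ys)) n"
  by (induction n) simp_all

lemma length_channel_outputs: "ys \<in> set_pmf (channel_outputs P f n) \<Longrightarrow> length ys = n"
  by (induction n arbitrary: ys) auto

lemma pmf_channel_outputs_snoc:
  "pmf (channel_outputs P f (Suc n)) (ys @ [y]) = pmf (channel_outputs P f n) ys * pmf (P (f ys)) y"
proof -
  have *: "pmf (map_pmf (\<lambda>y. zs @ [y]) (P (f zs))) (ys @ [y]) = indicator {ys} zs * pmf (P (f ys)) y" for zs
  proof (cases "zs = ys")
    case True
    then show ?thesis
      using pmf_map_inj'[of "\<lambda>y. ys @ [y]" "P (f ys)" y] by (simp add: inj_def)
  qed (auto simp: pmf_eq_0_set_pmf)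
  show ?thesis
    by (simp add: pmf_bind * measure_pmf_single)
qed

lemma finite_lists_of_length: "finite {ys :: 'y::finite list. length ys = n}"
  using finite_lists_length_eq[of "UNIV :: 'y set" n] by simp

lemma prob_channel_outputs:
  fixes P :: "'x \<Rightarrow> 'y::finite pmf"
  shows "measure_pmf.prob (channel_outputs P f n) A =
    (\<Sum>ys | length ys = n. indicator A ys * pmf (channel_outputs P f n) ys)"
proof -
  have "measure_pmf.prob (channel_outputs P f n) A = measure_pmf.prob (channel_outputs P f n) (A \<inter> {ys. length ys = n})"
    by (intro measure_pmf.finite_measure_eq_AE) (auto simp: AE_measure_pmf_iff length_channel_outputs)
  also have "\<dots> = sum (pmf (channel_outputs P f n)) (A \<inter> {ys. length ys = n})"
    by (intro measure_measure_pmf_finite) (simp add: finite_lists_of_length)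
  also have "\<dots> = (\<Sum>ys | length ys = n. indicator A ys * pmf (channel_outputs P f n) ys)"
    by (intro sum.mono_neutral_cong_left) (auto simp: finite_lists_of_length indicator_def)
  finally show ?thesis .
qed

lemma sum_lists_Suc:
  fixes h :: "'y::finite list \<Rightarrow> real"
  shows "(\<Sum>ys | length ys = Suc n. h ys) = (\<Sum>ys | length ys = n. \<Sum>y\<in>UNIV. h (ys @ [y]))"
proof -
  have "(\<Sum>ys | length ys = n. \<Sum>y\<in>UNIV. h (ys @ [y])) =
      (\<Sum>(ys, y)\<in>{ys. length ys = n} \<times> UNIV. h (ys @ [y]))"
    by (simp add: sum.cartesian_product)
  also have "\<dots> = (\<Sum>ys | length ys = Suc n. h ys)"
    by (rule sum.reindex_bij_witness[of _ "\<lambda>ys. (butlast ys, last ys)" "\<lambda>(ys, y). ys @ [y]"])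
      (auto simp: length_Suc_conv_rev)
  finally show ?thesis ..
qed

lemma exp_le_quadratic:
  fixes x :: real
  assumes "\<bar>x\<bar> \<le> 1"
  shows "exp x \<le> 1 + x + x\<^sup>2"
proof (cases "0 \<le> x")
  case True
  then show ?thesis using assms by (intro exp_bound) auto
next
  case False
  have "exp x = 1 / exp (- x)" by (simp add: exp_minus field_simps)
  also have "\<dots> \<le> 1 / (1 + - x)"
    using False exp_ge_add_one_self[of "- x"] by (intro divide_left_mono) auto
  also have "\<dots> \<le> 1 + x + x\<^sup>2"
  proof -
    have "0 \<le> - x * x\<^sup>2" using False by (intro mult_nonneg_nonneg) auto
    then have "1 \<le> (1 + x + x\<^sup>2) * (1 + - x)"
      by (simp add: algebra_simps power2_eq_square)
    then show ?thesis using False by (simp add: divide_le_eq)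
  qed
  finally show ?thesis .
qed

text \<open>The first-order term of the moment of order \<open>s\<close> is
  \<open>s * kl p q\<close>; the bound \<open>B\<close> on the log-ratio makes the remainder
  uniform, and \<open>s * B \<le> 1\<close> keeps the exponential in the range of its quadratic
  bound.\<close>

lemma renyi_step:
  fixes p q :: "'y::finite pmf"
  assumes dom: "\<And>y. y \<in> set_pmf p \<Longrightarrow> y \<in> set_pmf q \<and> \<bar>ln (pmf p y / pmf q y)\<bar> \<le> B"
    and s: "0 \<le> s" "s * B \<le> 1"
  shows "(\<Sum>y\<in>UNIV. pmf p y * (pmf p y / pmf q y) powr s) \<le> exp (s * kl p q + s\<^sup>2 * B\<^sup>2)"
proof -
  have "(\<Sum>y\<in>UNIV. pmf p y * (pmf p y / pmf q y) powr s)
      \<le> (\<Sum>y\<in>UNIV. pmf p y * (1 + s\<^sup>2 * B\<^sup>2) + s * (pmf p y * ln (pmf p y / pmf q y)))"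
  proof (rule sum_mono)
    fix y
    show "pmf p y * (pmf p y / pmf q y) powr s \<le> pmf p y * (1 + s\<^sup>2 * B\<^sup>2) + s * (pmf p y * ln (pmf p y / pmf q y))"
    proof (cases "y \<in> set_pmf p")
      case True
      define L where "L = ln (pmf p y / pmf q y)"
      have pos: "0 < pmf p y" "0 < pmf q y"
        using True dom by (auto simp: pmf_positive)
      have L: "\<bar>L\<bar> \<le> B"
        using True dom by (simp add: L_def)
      have sL: "\<bar>s * L\<bar> \<le> s * B"
        using L s by (simp add: abs_mult mult_left_mono)
      have "(pmf p y / pmf q y) powr s = exp (s * L)"
        using pos by (simp add: powr_def L_def)
      also have "\<dots> \<le> 1 + s * L + (s * L)\<^sup>2"
        using sL s by (intro exp_le_quadratic) auto
      also have "(s * L)\<^sup>2 \<le> s\<^sup>2 * B\<^sup>2"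
        using sL power_mono[of "\<bar>s * L\<bar>" "s * B" 2] by (simp add: power_mult_distrib)
      finally have "(pmf p y / pmf q y) powr s \<le> 1 + s * L + s\<^sup>2 * B\<^sup>2"
        by simp
      then have "pmf p y * (pmf p y / pmf q y) powr s \<le> pmf p y * (1 + s * L + s\<^sup>2 * B\<^sup>2)"
        using pos by (intro mult_left_mono) auto
      then show ?thesis
        by (simp add: L_def algebra_simps)
    qed (simp add: set_pmf_eq)
  qed
  also have "\<dots> = 1 + (s * kl p q + s\<^sup>2 * B\<^sup>2)"
    by (simp add: sum.distrib kl_def sum_distrib_left[symmetric] sum_distrib_right[symmetric] sum_pmf_eq_1)
  also have "\<dots> \<le> exp (s * kl p q + s\<^sup>2 * B\<^sup>2)"
    by (rule exp_ge_add_one_self)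
  finally show ?thesis .
qed

text \<open>Conditioned on the past, the newest factor contributes at most a bound that depends on
  time alone, so dependence between letters does no harm. The time dependence of \<open>d\<close>
  allows for switching between auxiliary channels.\<close>

lemma renyi_feedback_law:
  fixes \<kappa> \<kappa>' :: "'y::finite list \<Rightarrow> 'y pmf"
  assumes dom: "\<And>ys y. y \<in> set_pmf (\<kappa> ys) \<Longrightarrow> y \<in> set_pmf (\<kappa>' ys) \<and> \<bar>ln (pmf (\<kappa> ys) y / pmf (\<kappa>' ys) y)\<bar> \<le> B"
    and kl: "\<And>ys. kl (\<kappa> ys) (\<kappa>' ys) \<le> d (length ys)"
    and s: "0 \<le> s" "s * B \<le> 1"
  shows "(\<Sum>ys | length ys = n. pmf (feedback_law \<kappa> n) ys * (pmf (feedback_law \<kappa> n) ys / pmf (feedback_law \<kappa>' n) ys) powr s)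
    \<le> exp (s * (\<Sum>i<n. d i) + real n * (s\<^sup>2 * B\<^sup>2))" (is "?G n \<le> _")
proof (induction n)
  case (Suc n)
  let ?p = "\<lambda>ys. pmf (feedback_law \<kappa> n) ys" and ?p' = "\<lambda>ys. pmf (feedback_law \<kappa>' n) ys"
  have step: "(\<Sum>y\<in>UNIV. pmf (\<kappa> ys) y * (pmf (\<kappa> ys) y / pmf (\<kappa>' ys) y) powr s) \<le> exp (s * d n + s\<^sup>2 * B\<^sup>2)"
    if "length ys = n" for ys
  proof -
    have "s * kl (\<kappa> ys) (\<kappa>' ys) \<le> s * d n"
      using kl[of ys] that s by (intro mult_left_mono) auto
    then show ?thesis
      using renyi_step[of "\<kappa> ys" "\<kappa>' ys" B s, OF dom s] by (simp add: order_trans)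
  qed
  have "?G (Suc n) = (\<Sum>ys | length ys = n. ?p ys * (?p ys / ?p' ys) powr s *
      (\<Sum>y\<in>UNIV. pmf (\<kappa> ys) y * (pmf (\<kappa> ys) y / pmf (\<kappa>' ys) y) powr s))"
    unfolding sum_lists_Suc pmf_channel_outputs_snoc times_divide_times_eq[symmetric] sum_distrib_left
    by (intro sum.cong refl, subst powr_mult) (simp_all add: mult_ac)
  also have "\<dots> \<le> (\<Sum>ys | length ys = n. ?p ys * (?p ys / ?p' ys) powr s * exp (s * d n + s\<^sup>2 * B\<^sup>2))"
    by (intro sum_mono mult_left_mono step) auto
  also have "\<dots> = ?G n * exp (s * d n + s\<^sup>2 * B\<^sup>2)"
    by (simp add: sum_distrib_right)
  also have "\<dots> \<le> exp (s * (\<Sum>i<n. d i) + real n * (s\<^sup>2 * B\<^sup>2)) * exp (s * d n + s\<^sup>2 * B\<^sup>2)"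
    using Suc.IH by (intro mult_right_mono) auto
  also have "\<dots> = exp (s * (\<Sum>i<Suc n. d i) + real (Suc n) * (s\<^sup>2 * B\<^sup>2))"
    by (simp add: exp_add[symmetric] algebra_simps)
  finally show ?case .
qed simp

lemma feedback_law_dominated:
  fixes \<kappa> \<kappa>' :: "'y::finite list \<Rightarrow> 'y pmf"
  assumes "\<And>ys. set_pmf (\<kappa> ys) \<subseteq> set_pmf (\<kappa>' ys)"
  shows "set_pmf (feedback_law \<kappa> n) \<subseteq> set_pmf (feedback_law \<kappa>' n)"
  using assms by (induction n) (auto, blast)

text \<open>Output words whose likelihood ratio is at most \<open>exp (D + n \<eta>)\<close>, with
  \<open>D\<close> the sum of the \<open>d i\<close>, are paid for by the other law; the remaining
  ones are rare by Markov's inequality for the power \<open>s\<close> of the ratio.\<close>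

lemma change_of_measure:
  fixes \<kappa> \<kappa>' :: "'y::finite list \<Rightarrow> 'y pmf"
  assumes dom: "\<And>ys y. y \<in> set_pmf (\<kappa> ys) \<Longrightarrow> y \<in> set_pmf (\<kappa>' ys) \<and> \<bar>ln (pmf (\<kappa> ys) y / pmf (\<kappa>' ys) y)\<bar> \<le> B"
    and kl: "\<And>ys. kl (\<kappa> ys) (\<kappa>' ys) \<le> d (length ys)"
    and "1 \<le> B" "0 < \<eta>"
  shows "measure_pmf.prob (feedback_law \<kappa> n) A
    \<le> exp ((\<Sum>i<n. d i) + real n * \<eta>) * measure_pmf.prob (feedback_law \<kappa>' n) A
      + exp (- (real n * (min 1 (\<eta> / 2) / B\<^sup>2 * (\<eta> / 2))))"
proof -
  \<comment> \<open>With \<open>s * B\<^sup>2 \<le> \<eta> / 2\<close> the quadratic loss eats at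
    most half of the gain \<open>s * \<eta>\<close>. The minimum with 1, together with
    \<open>1 \<le> B\<close>, yields \<open>s * B \<le> 1\<close>.\<close>
  define s where "s = min 1 (\<eta> / 2) / B\<^sup>2"
  define D where "D = (\<Sum>i<n. d i)"
  define a where "a = exp (D + real n * \<eta>)"
  let ?p = "\<lambda>ys. pmf (feedback_law \<kappa> n) ys" and ?p' = "\<lambda>ys. pmf (feedback_law \<kappa>' n) ys"
  have s: "0 < s" "s * B\<^sup>2 \<le> \<eta> / 2" "s * B\<^sup>2 \<le> 1"
    using assms(3,4) by (auto simp: s_def)
  have "s * B \<le> s * B\<^sup>2"
    using s assms(3) by (simp add: power2_eq_square)
  then have sB: "s * B \<le> 1"
    using s by linarith
  have pointwise: "?p ys \<le> a * ?p' ys + a powr (- s) * (?p ys * (?p ys / ?p' ys) powr s)" for ys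
  proof (cases "?p ys \<le> a * ?p' ys")
    case True
    then show ?thesis by (simp add: add_increasing2)
  next
    case False
    then have p: "0 < ?p ys"
      by (smt (verit) a_def exp_gt_zero mult_nonneg_nonneg pmf_nonneg)
    moreover have "set_pmf (feedback_law \<kappa> n) \<subseteq> set_pmf (feedback_law \<kappa>' n)"
      using dom by (intro feedback_law_dominated) auto
    ultimately have p': "0 < ?p' ys"
      by (auto simp: pmf_positive_iff)
    have "a powr s \<le> (?p ys / ?p' ys) powr s"
      using False p' s by (intro powr_mono2) (auto simp: a_def field_simps)
    then have "a powr (- s) * (?p ys * a powr s) \<le> a powr (- s) * (?p ys * (?p ys / ?p' ys) powr s)"
      by (intro mult_left_mono) auto
    moreover have "a powr (- s) * (?p ys * a powr s) = ?p ys"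
      by (simp add: powr_minus a_def)
    moreover have "0 \<le> a * ?p' ys"
      by (simp add: a_def)
    ultimately show ?thesis by linarith
  qed
  have "measure_pmf.prob (feedback_law \<kappa> n) A
      \<le> (\<Sum>ys | length ys = n. indicator A ys * (a * ?p' ys + a powr (- s) * (?p ys * (?p ys / ?p' ys) powr s)))"
    unfolding prob_channel_outputs by (intro sum_mono mult_left_mono pointwise) auto
  also have "\<dots> \<le> (\<Sum>ys | length ys = n. a * (indicator A ys * ?p' ys) + a powr (- s) * (?p ys * (?p ys / ?p' ys) powr s))"
    by (intro sum_mono) (auto simp: indicator_def)
  also have "\<dots> = a * measure_pmf.prob (feedback_law \<kappa>' n) A
      + a powr (- s) * (\<Sum>ys | length ys = n. ?p ys * (?p ys / ?p' ys) powr s)"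
    by (simp add: sum.distrib prob_channel_outputs sum_distrib_left)
  also have "\<dots> \<le> a * measure_pmf.prob (feedback_law \<kappa>' n) A
      + a powr (- s) * exp (s * D + real n * (s\<^sup>2 * B\<^sup>2))"
    unfolding D_def using s sB dom kl
    by (intro add_left_mono mult_left_mono renyi_feedback_law) auto
  also have "a powr (- s) * exp (s * D + real n * (s\<^sup>2 * B\<^sup>2)) = exp (- (real n * (s * \<eta> - s\<^sup>2 * B\<^sup>2)))"
    by (simp add: a_def powr_def exp_add[symmetric] algebra_simps)
  also have "\<dots> \<le> exp (- (real n * (s * (\<eta> / 2))))"
  proof -
    have "s\<^sup>2 * B\<^sup>2 \<le> s * (\<eta> / 2)"
      using mult_left_mono[OF s(2), of s] s by (simp add: power2_eq_square mult.assoc)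
    then have "real n * (s * (\<eta> / 2)) \<le> real n * (s * \<eta> - s\<^sup>2 * B\<^sup>2)"
      by (intro mult_left_mono) (auto simp: mult.commute)
    then show ?thesis by simp
  qed
  finally show ?thesis
    by (simp add: a_def D_def s_def)
qed

section \<open>Haroutunian's bound\<close>

lemma prob_transmission:
  assumes "1 \<le> M"
  shows "measure_pmf.prob (transmission P M f n) {(w, ys). A w ys} =
    (\<Sum>w\<in>{1..M}. measure_pmf.prob (channel_outputs P (f w) n) {ys. A w ys}) / real M"
proof -
  have "measure_pmf.prob (transmission P M f n) {(w, ys). A w ys} =
      (\<integral>w. measure_pmf.prob (channel_outputs P (f w) n) {ys. A w ys} \<partial>measure_pmf (pmf_of_set {1..M}))"
    unfolding transmission_def measure_pmf_bind
    by (subst measure_pmf.measure_bind[where N = "count_space UNIV"]) 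
      (auto simp: vimage_def space_subprob_algebra intro: prob_space_imp_subprob_space measure_pmf.prob_space_axioms)
  also have "\<dots> = (\<Sum>w\<in>{1..M}. measure_pmf.prob (channel_outputs P (f w) n) {ys. A w ys}) / real M"
    using assms by (simp add: integral_pmf_of_set)
  finally show ?thesis .
qed

text \<open>Here the number of messages enters: under an output law that ignores the message, all
  success probabilities share a total mass of one.\<close>

lemma sum_prob_decode_le_one:
  "(\<Sum>w\<in>{1..M}. measure_pmf.prob p {ys. dec ys = (w::nat)}) \<le> 1"
proof -
  have "(\<Sum>w\<in>{1..M}. measure_pmf.prob p {ys. dec ys = w}) = measure_pmf.prob p (\<Union>w\<in>{1..M}. {ys. dec ys = w})"
    by (intro measure_pmf.finite_measure_finite_Union[symmetric]) (auto simp: disjoint_family_on_def)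
  then show ?thesis by simp
qed

text \<open>The error events are compared under three laws of the outputs: \<open>P\<close>, the auxiliary channel
  \<open>W\<close>, and the product law \<open>q\<close> under which the outputs carry no information on the message.\<close>

lemma error_prob_lower_bound:
  fixes P :: "'x \<Rightarrow> 'y::finite pmf" and W :: "nat \<Rightarrow> 'x \<Rightarrow> 'y pmf" and q :: "nat \<Rightarrow> 'y pmf"
  assumes q: "\<And>i x y. y \<in> set_pmf (W i x) \<Longrightarrow> y \<in> set_pmf (q i) \<and> \<bar>ln (pmf (W i x) y / pmf (q i) y)\<bar> \<le> B"
    and P: "\<And>i x y. y \<in> set_pmf (W i x) \<Longrightarrow> y \<in> set_pmf (P x) \<and> \<bar>ln (pmf (W i x) y / pmf (P x) y)\<bar> \<le> B"
    and klq: "\<And>i x. kl (W i x) (q i) \<le> r i"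
    and klP: "\<And>i x. kl (W i x) (P x) \<le> d i"
    and "1 \<le> B" "0 < \<eta>" "1 \<le> M"
  shows "1 - exp ((\<Sum>i<n. r i) + real n * \<eta>) / real M
        - 2 * exp (- (real n * (min 1 (\<eta> / 2) / B\<^sup>2 * (\<eta> / 2))))
    \<le> exp ((\<Sum>i<n. d i) + real n * \<eta>) * measure_pmf.prob (transmission P M f n) {(w, ys). dec ys \<noteq> w}"
proof -
  define \<rho> where "\<rho> = exp ((\<Sum>i<n. r i) + real n * \<eta>)"
  define \<sigma> where "\<sigma> = exp ((\<Sum>i<n. d i) + real n * \<eta>)"
  define \<delta> where "\<delta> = exp (- (real n * (min 1 (\<eta> / 2) / B\<^sup>2 * (\<eta> / 2))))"
  define Q where "Q = feedback_law (\<lambda>ys. q (length ys)) n"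
  \<comment> \<open>Under the auxiliary law success and failure have total probability one; success
    is charged to \<open>Q\<close> and failure to \<open>P\<close>, each with an additive loss
    \<delta>.\<close>
  have each: "1 - 2 * \<delta> \<le> \<rho> * measure_pmf.prob Q {ys. dec ys = w}
      + \<sigma> * measure_pmf.prob (channel_outputs P (f w) n) {ys. dec ys \<noteq> w}" for w
  proof -
    let ?L = "feedback_law (\<lambda>ys. W (length ys) (f w ys)) n"
    have "measure_pmf.prob ?L {ys. dec ys = w} \<le> \<rho> * measure_pmf.prob Q {ys. dec ys = w} + \<delta>"
      unfolding \<rho>_def \<delta>_def Q_def by (rule change_of_measure) (use assms in auto)
    moreover have "measure_pmf.prob ?L {ys. dec ys \<noteq> w}
        \<le> \<sigma> * measure_pmf.prob (channel_outputs P (f w) n) {ys. dec ys \<noteq> w} + \<delta>"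
      unfolding \<sigma>_def \<delta>_def channel_outputs_eq_feedback_law[of P]
      by (rule change_of_measure) (use assms in auto)
    moreover have "measure_pmf.prob ?L {ys. dec ys \<noteq> w} = 1 - measure_pmf.prob ?L {ys. dec ys = w}"
      using measure_pmf.prob_compl[of "{ys. dec ys = w}" ?L] by (simp add: Compl_eq_Diff_UNIV[symmetric] Collect_neg_eq)
    ultimately show ?thesis by linarith
  qed
  have "real M * (1 - 2 * \<delta>) = (\<Sum>w\<in>{1..M}. 1 - 2 * \<delta>)"
    by simp
  also have "\<dots> \<le> (\<Sum>w\<in>{1..M}. \<rho> * measure_pmf.prob Q {ys. dec ys = w}
      + \<sigma> * measure_pmf.prob (channel_outputs P (f w) n) {ys. dec ys \<noteq> w})"
    by (rule sum_mono) (rule each)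
  also have "\<dots> = \<rho> * (\<Sum>w\<in>{1..M}. measure_pmf.prob Q {ys. dec ys = w})
      + \<sigma> * (real M * measure_pmf.prob (transmission P M f n) {(w, ys). dec ys \<noteq> w})"
    using assms(7) by (simp add: prob_transmission sum.distrib sum_distrib_left[symmetric])
  also have "\<dots> \<le> \<rho> * 1 + \<sigma> * (real M * measure_pmf.prob (transmission P M f n) {(w, ys). dec ys \<noteq> w})"
    by (intro add_right_mono mult_left_mono sum_prob_decode_le_one) (simp add: \<rho>_def)
  finally have "1 - 2 * \<delta> \<le> (\<rho> + \<sigma> * (real M * measure_pmf.prob (transmission P M f n) {(w, ys). dec ys \<noteq> w})) / real M"
    using assms(7) by (simp add: pos_le_divide_eq mult.commute)
  also have "\<dots> = \<rho> / real M + \<sigma> * measure_pmf.prob (transmission P M f n) {(w, ys). dec ys \<noteq> w}"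
    using assms(7) by (simp add: add_divide_distrib)
  finally show ?thesis
    by (simp add: \<rho>_def \<sigma>_def \<delta>_def)
qed

lemma sum_if_less:
  fixes a b :: real
  assumes "k \<le> n"
  shows "(\<Sum>i<n. if i < k then a else b) = real k * a + (real n - real k) * b"
proof -
  have "{..<n} \<inter> {i. i < k} = {..<k}" "{..<n} \<inter> - {i. i < k} = {k..<n}"
    using assms by auto
  then show ?thesis
    using assms by (simp add: sum.If_cases of_nat_diff)
qed

lemma eventually_exp_le:
  fixes a b :: real
  assumes "0 < a" "0 < b"
  shows "\<forall>\<^sub>F n in sequentially. exp (- (real n * a)) \<le> b"
proof -
  have "\<forall>\<^sub>F n in sequentially. - ln b / a \<le> real n"
    using filterlim_real_sequentially by (simp add: filterlim_at_top)
  then show ?thesis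
  proof eventually_elim
    case (elim n)
    then have "- (real n * a) \<le> ln b"
      using assms by (simp add: field_simps)
    then show ?case
      using assms by (simp add: ln_ge_iff)
  qed
qed

text \<open>If \<open>V\<close> has capacity exactly \<open>R\<close>, it need not force errors at rate \<open>R\<close>. Using \<open>V0\<close>, whose
  capacity is strictly smaller, for a small fraction \<open>t\<close> of the time leaves a linear deficit.\<close>

lemma haroutunian_error_bound:
  fixes P V V0 :: "'x::finite \<Rightarrow> 'y::finite pmf"
  assumes V: "\<And>x. set_pmf (V x) \<subseteq> set_pmf (P x)" "\<And>x. kl (V x) (P x) \<le> D" "capacity V \<le> R"
    and V0: "\<And>x. set_pmf (V0 x) \<subseteq> set_pmf (P x)" "\<And>x. kl (V0 x) (P x) \<le> D0" "capacity V0 < R"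
    and \<eta>: "0 < \<eta>"
  shows "\<forall>\<^sub>F n in sequentially. \<forall>M f dec. 2 powr (real n * R) \<le> real M \<longrightarrow>
    exp (- (real n * (D + \<eta>))) / 2 \<le> measure_pmf.prob (transmission P M f n) {(w, ys). dec ys \<noteq> w}"
proof -
  have D0: "0 \<le> D0" and D: "0 \<le> D"
    using kl_nonneg[OF V0(1)] kl_nonneg[OF V(1)] V0(2) V(2) order_trans by blast+
  \<comment> \<open>Small enough for the time spent on \<open>V0\<close> to raise the divergence
    from \<open>P\<close> by at most \<open>\<eta> / 4\<close> per letter.\<close>
  define t where "t = min (1 / 2) (\<eta> / (4 * (D0 + 1)))"
  have t: "0 < t" "t < 1" "t * D0 \<le> \<eta> / 4"
  proof -
    show "0 < t" "t < 1" using D0 \<eta> by (auto simp: t_def)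
    have "t * (D0 + 1) \<le> \<eta> / (4 * (D0 + 1)) * (D0 + 1)"
      using D0 by (intro mult_right_mono) (auto simp: t_def)
    also have "\<dots> = \<eta> / 4" using D0 by (simp add: field_simps)
    finally show "t * D0 \<le> \<eta> / 4" using \<open>0 < t\<close> by (simp add: algebra_simps)
  qed
  define \<rho> where "\<rho> = (R - capacity V0) * ln 2"
  have \<rho>: "0 < \<rho>" using V0(3) by (simp add: \<rho>_def)
  \<comment> \<open>\<beta> is charged twice per letter, as slack of the output laws and in the
    change of measure, so half of the deficit \<open>t * \<rho>\<close> survives. Against
    \<open>P\<close> it is charged once, costing at most \<open>\<eta> / 4\<close>.\<close>
  define \<beta> where "\<beta> = min (t * \<rho> / 4) (\<eta> / 4)"
  have \<beta>: "0 < \<beta>" "\<beta> \<le> t * \<rho> / 4" "\<beta> \<le> \<eta> / 4"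
    using t \<rho> \<eta> by (auto simp: \<beta>_def)
  obtain q where q: "\<And>x. set_pmf (V x) \<subseteq> set_pmf q" "\<And>x. kl (V x) q \<le> capacity V * ln 2 + \<beta>"
    using ex_output_pmf_kl_le_capacity[OF \<beta>(1), of V] by metis
  obtain q0 where q0: "\<And>x. set_pmf (V0 x) \<subseteq> set_pmf q0" "\<And>x. kl (V0 x) q0 \<le> capacity V0 * ln 2 + \<beta>"
    using ex_output_pmf_kl_le_capacity[OF \<beta>(1), of V0] by metis
  \<comment> \<open>The alphabets are finite, so one \<open>B\<close> bounds all four log-ratios,
    independently of blocklength and code.\<close>
  define h where "h = (\<lambda>(x, y). \<bar>ln (pmf (V x) y / pmf q y)\<bar> + \<bar>ln (pmf (V0 x) y / pmf q0 y)\<bar>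
      + \<bar>ln (pmf (V x) y / pmf (P x) y)\<bar> + \<bar>ln (pmf (V0 x) y / pmf (P x) y)\<bar>)"
  define B where "B = max 1 (Max (range h))"
  have B: "1 \<le> B" by (simp add: B_def)
  have "h z \<le> Max (range h)" for z by (intro Max_ge) auto
  then have hB: "h (x, y) \<le> B" for x y by (simp add: B_def le_max_iff_disj)
  define c where "c = min 1 (\<beta> / 2) / B\<^sup>2 * (\<beta> / 2)"
  have c: "0 < c" using \<beta> B by (simp add: c_def)
  \<comment> \<open>The second term occurs twice in the error bound, so 1/6 leaves
    \<open>1 - 3 / 6 = 1 / 2\<close>.\<close>
  have ev: "\<forall>\<^sub>F n in sequentially. exp (- (real n * (t * \<rho> / 2))) \<le> 1 / 6"
      "\<forall>\<^sub>F n in sequentially. exp (- (real n * c)) \<le> 1 / 6"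
    by (intro eventually_exp_le; use t \<rho> c in simp)+
  \<comment> \<open>Rounding \<open>t * n\<close> up to a whole number of letters costs at most one
    extra \<open>D0\<close>, which this absorbs into \<open>n * \<eta> / 2\<close>.\<close>
  have evD: "\<forall>\<^sub>F n in sequentially. 2 * D0 / \<eta> \<le> real n"
    using filterlim_real_sequentially by (simp add: filterlim_at_top)
  show ?thesis
    using ev evD
  proof eventually_elim
    case (elim n)
    show ?case
    proof (intro allI impI)
      fix M f and dec :: "'y list \<Rightarrow> nat"
      assume M: "2 powr (real n * R) \<le> real M"
      have M1: "1 \<le> M"
        using M by (cases M) (auto simp: not_le)
      define k where "k = nat \<lceil>t * real n\<rceil>"
      have k: "t * real n \<le> real k" "real k \<le> t * real n + 1" "k \<le> n"
      proof -
        show "t * real n \<le> real k" "real k \<le> t * real n + 1"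
          using t by (simp_all add: k_def)
        have "t * real n \<le> real n" using t mult_right_mono[of t 1 "real n"] by simp
        then show "k \<le> n" by (simp add: k_def ceiling_le_iff nat_le_iff)
      qed
      let ?W = "\<lambda>i. if i < k then V0 else V" and ?q = "\<lambda>i. if i < k then q0 else q"
      let ?r = "\<lambda>i. if i < k then capacity V0 * ln 2 + \<beta> else R * ln 2 + \<beta>"
      let ?d = "\<lambda>i. if i < k then D0 else D"
      have r: "kl (?W i x) (?q i) \<le> ?r i" for i x
        using q(2)[of x] q0(2)[of x] mult_right_mono[OF V(3), of "ln 2"] by (auto intro: order_trans)
      have "1 - exp ((\<Sum>i<n. ?r i) + real n * \<beta>) / real M
            - 2 * exp (- (real n * (min 1 (\<beta> / 2) / B\<^sup>2 * (\<beta> / 2))))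
          \<le> exp ((\<Sum>i<n. ?d i) + real n * \<beta>) * measure_pmf.prob (transmission P M f n) {(w, ys). dec ys \<noteq> w}"
      proof (rule error_prob_lower_bound[where W = ?W and q = ?q])
        fix i x y assume y: "y \<in> set_pmf (?W i x)"
        show "y \<in> set_pmf (?q i) \<and> \<bar>ln (pmf (?W i x) y / pmf (?q i) y)\<bar> \<le> B"
          using y q(1)[of x] q0(1)[of x] hB[of x y] by (auto simp: h_def split: if_splits)
        show "y \<in> set_pmf (P x) \<and> \<bar>ln (pmf (?W i x) y / pmf (P x) y)\<bar> \<le> B"
          using y V(1)[of x] V0(1)[of x] hB[of x y] by (auto simp: h_def split: if_splits)
      qed (use r V(2) V0(2) B \<beta> M1 in auto)
      moreover have "exp ((\<Sum>i<n. ?r i) + real n * \<beta>) / real M \<le> 1 / 6"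
      proof -
        have "(\<Sum>i<n. ?r i) + real n * \<beta> = real n * (R * ln 2) - real k * \<rho> + 2 * (real n * \<beta>)"
          using k by (simp add: sum_if_less \<rho>_def algebra_simps)
        also have "\<dots> \<le> real n * (R * ln 2) - t * real n * \<rho> + 2 * (real n * (t * \<rho> / 4))"
          using k \<rho> \<beta> by (intro add_mono diff_mono mult_right_mono mult_left_mono) auto
        also have "\<dots> = real n * (R * ln 2) + - (real n * (t * \<rho> / 2))"
          by (simp add: field_simps)
        finally have "exp ((\<Sum>i<n. ?r i) + real n * \<beta>) \<le> exp (real n * (R * ln 2)) * exp (- (real n * (t * \<rho> / 2)))"
          by (simp add: exp_add[symmetric])
        also have "exp (real n * (R * ln 2)) = 2 powr (real n * R)"
          by (simp add: powr_def mult.assoc)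
        also have "2 powr (real n * R) * exp (- (real n * (t * \<rho> / 2))) \<le> real M * (1 / 6)"
          using M elim by (intro mult_mono) auto
        finally show ?thesis
          using M1 by (simp add: divide_le_eq)
      qed
      ultimately have "1 / 2 \<le> exp ((\<Sum>i<n. ?d i) + real n * \<beta>) * measure_pmf.prob (transmission P M f n) {(w, ys). dec ys \<noteq> w}"
        using elim(2) unfolding c_def by linarith
      also have "\<dots> \<le> exp (real n * (D + \<eta>)) * measure_pmf.prob (transmission P M f n) {(w, ys). dec ys \<noteq> w}"
      proof (intro mult_right_mono)
        have "(\<Sum>i<n. ?d i) + real n * \<beta> = real k * D0 + (real n - real k) * D + real n * \<beta>"
          using k by (simp add: sum_if_less)
        also have "\<dots> \<le> (t * real n + 1) * D0 + real n * D + real n * (\<eta> / 4)"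
          using k \<beta> D D0 by (intro add_mono mult_right_mono mult_left_mono) auto
        also have "\<dots> = real n * (t * D0) + D0 + real n * D + real n * (\<eta> / 4)"
          by (simp add: algebra_simps)
        also have "\<dots> \<le> real n * (\<eta> / 4) + real n * \<eta> / 2 + real n * D + real n * (\<eta> / 4)"
          using t elim(3) \<eta> by (intro add_mono mult_left_mono) (auto simp: field_simps)
        also have "\<dots> = real n * (D + \<eta>)"
          by (simp add: field_simps)
        finally show "exp ((\<Sum>i<n. ?d i) + real n * \<beta>) \<le> exp (real n * (D + \<eta>))"
          by simp
      qed simp
      finally show "exp (- (real n * (D + \<eta>))) / 2 \<le> measure_pmf.prob (transmission P M f n) {(w, ys). dec ys \<noteq> w}"
        unfolding exp_minus by (simp add: field_simps)
    qed
  qed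
qed

section \<open>Common randomness and stopping\<close>

lemma borel_measurable_pmf_channel_outputs:
  assumes F: "\<And>ys. (\<lambda>u. F u ys) \<in> U \<rightarrow>\<^sub>M count_space UNIV"
  shows "(\<lambda>u. pmf (channel_outputs P (F u) n) ys) \<in> borel_measurable U"
proof (induction n arbitrary: ys)
  case (Suc n)
  show ?case
  proof (cases ys rule: rev_cases)
    case Nil
    then have "pmf (channel_outputs P (F u) (Suc n)) ys = 0" for u
      using length_channel_outputs[of ys P "F u" "Suc n"] by (auto simp: pmf_eq_0_set_pmf)
    then show ?thesis by simp
  next
    case (snoc zs y)
    have "(\<lambda>u. pmf (P (F u zs)) y) \<in> borel_measurable U"
      by (rule measurable_compose[OF F]) simp
    then show ?thesis
      unfolding snoc pmf_channel_outputs_snoc by (intro borel_measurable_times Suc.IH)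
  qed
qed simp

text \<open>The Bochner integral in \<open>code_prob\<close> defaults to 0 for functions that are
  not integrable, so comparing or subtracting such probabilities rests on this. Only finitely many
  output words occur, and measurability in \<open>u\<close> is checked for each.\<close>

lemma integrable_prob_transmission:
  fixes P :: "'x \<Rightarrow> 'y::finite pmf"
  assumes "prob_space U" "feedback_encoder U M f" "1 \<le> M"
    and A: "\<And>w ys. (\<lambda>u. A u w ys) \<in> U \<rightarrow>\<^sub>M count_space UNIV"
  shows "integrable U (\<lambda>u. measure_pmf.prob (transmission P M (f u) n) {(w, ys). A u w ys})"
proof -
  interpret U: prob_space U by fact
  have A': "(\<lambda>u. indicator {ys. A u w ys} ys :: real) \<in> borel_measurable U" for w ys
    using measurable_compose[OF A[of w ys], of of_bool borel] by (simp add: indicator_def[abs_def])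
  have f: "(\<lambda>u. pmf (channel_outputs P (f u w) n) ys) \<in> borel_measurable U" if "w \<in> {1..M}" for w ys
    by (rule borel_measurable_pmf_channel_outputs)
      (use assms(2) that in \<open>simp add: feedback_encoder_def\<close>)
  have "(\<lambda>u. measure_pmf.prob (transmission P M (f u) n) {(w, ys). A u w ys}) \<in> borel_measurable U"
    unfolding prob_transmission[OF assms(3)] prob_channel_outputs
    by (intro borel_measurable_divide borel_measurable_sum borel_measurable_times A' f borel_measurable_const)
  then show ?thesis
    by (intro U.integrable_const_bound[where B = 1]) auto
qed

lemma code_prob_mono:
  fixes P :: "'x \<Rightarrow> 'y::finite pmf"
  assumes "prob_space U" "feedback_encoder U M f" "1 \<le> M"
    and "\<And>w ys. (\<lambda>u. A u w ys) \<in> U \<rightarrow>\<^sub>M count_space UNIV"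
    and "\<And>w ys. (\<lambda>u. B u w ys) \<in> U \<rightarrow>\<^sub>M count_space UNIV"
    and "\<And>u w ys. A u w ys \<Longrightarrow> B u w ys"
  shows "code_prob U P M f n A \<le> code_prob U P M f n B"
  unfolding code_prob_def
  by (intro integral_mono integrable_prob_transmission measure_pmf.finite_measure_mono) (use assms in auto)

lemma code_prob_diff:
  fixes P :: "'x \<Rightarrow> 'y::finite pmf"
  assumes "prob_space U" "feedback_encoder U M f" "1 \<le> M"
    and "\<And>w ys. (\<lambda>u. A u w ys) \<in> U \<rightarrow>\<^sub>M count_space UNIV"
    and "\<And>w ys. (\<lambda>u. B u w ys) \<in> U \<rightarrow>\<^sub>M count_space UNIV"
    and sub: "\<And>u w ys. B u w ys \<Longrightarrow> A u w ys"
  shows "code_prob U P M f n A - code_prob U P M f n B = code_prob U P M f n (\<lambda>u w ys. A u w ys \<and> \<not> B u w ys)"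
proof -
  have "code_prob U P M f n A - code_prob U P M f n B =
      (\<integral>u. measure_pmf.prob (transmission P M (f u) n) {(w, ys). A u w ys}
        - measure_pmf.prob (transmission P M (f u) n) {(w, ys). B u w ys} \<partial>U)"
    unfolding code_prob_def
    by (intro Bochner_Integration.integral_diff[symmetric] integrable_prob_transmission) (use assms in auto)
  also have "\<dots> = code_prob U P M f n (\<lambda>u w ys. A u w ys \<and> \<not> B u w ys)"
    unfolding code_prob_def
  proof (intro Bochner_Integration.integral_cong refl)
    fix u
    have "measure_pmf.prob (transmission P M (f u) n) ({(w, ys). A u w ys} - {(w, ys). B u w ys}) =
        measure_pmf.prob (transmission P M (f u) n) {(w, ys). A u w ys}
        - measure_pmf.prob (transmission P M (f u) n) {(w, ys). B u w ys}"
      by (intro measure_pmf.finite_measure_Diff) (auto intro: sub)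
    moreover have "{(w, ys). A u w ys} - {(w, ys). B u w ys} = {(w, ys). A u w ys \<and> \<not> B u w ys}"
      by auto
    ultimately show "measure_pmf.prob (transmission P M (f u) n) {(w, ys). A u w ys}
        - measure_pmf.prob (transmission P M (f u) n) {(w, ys). B u w ys} =
        measure_pmf.prob (transmission P M (f u) n) {(w, ys). A u w ys \<and> \<not> B u w ys}"
      by simp
  qed
  finally show ?thesis .
qed

lemma map_take_channel_outputs:
  assumes "l \<le> n"
  shows "map_pmf (take l) (channel_outputs P f n) = channel_outputs P f l"
  using assms
proof (induction n rule: dec_induct)
  case base
  have "map_pmf (take l) (channel_outputs P f l) = map_pmf id (channel_outputs P f l)"
    by (intro map_pmf_cong) (auto dest: length_channel_outputs)
  then show ?case by simp
next
  case (step n)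
  have "map_pmf (take l) (channel_outputs P f (Suc n)) =
      bind_pmf (channel_outputs P f n) (\<lambda>ys. map_pmf (\<lambda>y. take l (ys @ [y])) (P (f ys)))"
    by (simp add: map_bind_pmf pmf.map_comp o_def)
  also have "\<dots> = bind_pmf (channel_outputs P f n) (\<lambda>ys. return_pmf (take l ys))"
    using step by (intro bind_pmf_cong) (auto simp: map_pmf_const dest: length_channel_outputs)
  also have "\<dots> = channel_outputs P f l"
    using step by (simp add: map_pmf_def[symmetric])
  finally show ?case .
qed

text \<open>AFLF events live on \<open>K * l\<close> outputs, error-erasure events on
  \<open>l\<close>; this puts both on the longer transmission.\<close>

lemma code_prob_take:
  assumes "l \<le> n" "1 \<le> M"
  shows "code_prob U P M f l A = code_prob U P M f n (\<lambda>u w ys. A u w (take l ys))"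
  unfolding code_prob_def prob_transmission[OF assms(2)] map_take_channel_outputs[OF assms(1), symmetric]
  by (simp add: vimage_def)

text \<open>The rule inspects prefixes only, so truncation either keeps the first stopping instant
  or leaves none. The value \<infinity> then serves as the signal to erase.\<close>

lemma halting_time_take:
  "halting_time stop (take l ys) = (if halting_time stop ys \<le> enat l then halting_time stop ys else \<infinity>)"
proof -
  define S where "S = {n \<in> {1..length ys}. stop (take n ys)}"
  have H: "halting_time stop ys = Inf (enat ` S)"
    by (simp add: halting_time_def S_def)
  have "{n \<in> {1..length (take l ys)}. stop (take n (take l ys))} = S \<inter> {..l}"
    by (auto simp: S_def min_def)
  then have Hl: "halting_time stop (take l ys) = Inf (enat ` (S \<inter> {..l}))"
    unfolding halting_time_def by simp
  show ?thesis
  proof (cases "Inf (enat ` S) \<le> enat l")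
    case True
    then have "S \<noteq> {}" by (auto simp: top_enat_def)
    then obtain m where "m \<in> S" by auto
    then have "Inf (enat ` S) \<in> enat ` S" by (intro wellorder_InfI[of "enat m"]) auto
    then obtain n where n: "n \<in> S" "Inf (enat ` S) = enat n" by auto
    then have "Inf (enat ` (S \<inter> {..l})) \<le> Inf (enat ` S)"
      using True by (auto intro: Inf_lower)
    moreover have "Inf (enat ` S) \<le> Inf (enat ` (S \<inter> {..l}))"
      by (intro Inf_superset_mono) auto
    ultimately show ?thesis
      using True by (simp add: H Hl)
  next
    case False
    have "Inf (enat ` S) \<le> enat l" if "n \<in> S" "n \<le> l" for n
      using that by (intro Inf_lower2[of "enat n"]) auto
    with False have "S \<inter> {..l} = {}" by auto
    then show ?thesis
      using False by (simp add: H Hl top_enat_def)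
  qed
qed

lemma measurable_halting_time:
  assumes "\<And>ys. (\<lambda>u. stop u ys) \<in> U \<rightarrow>\<^sub>M count_space UNIV"
  shows "(\<lambda>u. halting_time (stop u) ys) \<in> U \<rightarrow>\<^sub>M count_space UNIV"
proof -
  \<comment> \<open>The index set must not depend on \<open>u\<close>; instants at which the rule is
    silent contribute \<infinity>.\<close>
  have "halting_time (stop u) ys = (INF n\<in>{1..length ys}. if stop u (take n ys) then enat n else \<infinity>)" for u
    unfolding halting_time_def
  proof (rule antisym; rule INF_greatest)
    fix n assume "n \<in> {1..length ys}"
    then show "(INF n\<in>{n \<in> {1..length ys}. stop u (take n ys)}. enat n)
        \<le> (if stop u (take n ys) then enat n else \<infinity>)"
      by (auto intro!: INF_lower)
  next
    fix n assume n: "n \<in> {n \<in> {1..length ys}. stop u (take n ys)}"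
    then show "(INF n\<in>{1..length ys}. if stop u (take n ys) then enat n else \<infinity>) \<le> enat n"
      by (intro INF_lower2[of n]) auto
  qed
  moreover have "(\<lambda>u. INF n\<in>{1..length ys}. if stop u (take n ys) then enat n else \<infinity>) \<in> U \<rightarrow>\<^sub>M count_space UNIV"
  proof (rule measurable_INF)
    fix n
    show "(\<lambda>u. if stop u (take n ys) then enat n else \<infinity>) \<in> U \<rightarrow>\<^sub>M count_space UNIV"
      using measurable_compose[OF assms[of "take n ys"], of "\<lambda>b. if b then enat n else \<infinity>"] by simp
  qed simp
  ultimately show ?thesis by simp
qed

text \<open>The decoding time depends on \<open>u\<close> too, but takes countably many values, so
  measurability at each fixed time suffices.\<close>

lemma measurable_stopped_decoder:
  fixes g :: "real \<Rightarrow> 'y list \<Rightarrow> nat"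
  assumes "feedback_decoder U D g" "\<And>ys. (\<lambda>u. stop u ys) \<in> U \<rightarrow>\<^sub>M count_space UNIV"
  shows "(\<lambda>u. g u (take (the_enat (halting_time (stop u) ys)) ys)) \<in> U \<rightarrow>\<^sub>M count_space D"
  by (rule measurable_compose_countable[where f = "\<lambda>t u. g u (take (the_enat t) ys)",
        OF _ measurable_halting_time[OF assms(2)]])
    (use assms(1) in \<open>simp add: feedback_decoder_def\<close>)

section \<open>Exponents\<close>

text \<open>An undetected error of the new code is an error of the old one on a run that stopped by
  time \<open>l\<close>. Positivity of \<gamma> keeps the erasure bound strictly below 1.\<close>

lemma aflf_code_imp_ee_code:
  fixes P :: "'x::finite \<Rightarrow> 'y::finite pmf"
  assumes code: "aflf_code P l M \<gamma> K \<epsilon> U f g stop" and \<gamma>: "0 < \<gamma>"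
  shows "\<exists>g'. ee_code P l M \<epsilon> (2 powr (- (\<gamma> * real l))) U f g'"
proof -
  have l: "1 \<le> l" and M: "1 \<le> M" and K: "1 \<le> K" and \<epsilon>: "0 < \<epsilon>" "\<epsilon> < 1"
    and U: "prob_space U" and f: "feedback_encoder U M f" and g: "feedback_decoder U {1..M} g"
    and stop: "\<And>ys. (\<lambda>u. stop u ys) \<in> U \<rightarrow>\<^sub>M count_space UNIV"
    and late: "code_prob U P M f (K * l) (\<lambda>u w ys. halting_time (stop u) ys > enat l) \<le> 2 powr (- (\<gamma> * real l))"
    and err: "code_prob U P M f (K * l)
      (\<lambda>u w ys. g u (take (the_enat (halting_time (stop u) ys)) ys) \<noteq> w) \<le> \<epsilon>"
    using code by (auto simp: aflf_code_def)
  define g' where "g' = (\<lambda>u ys. if halting_time (stop u) ys = \<infinity> then None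
      else Some (g u (take (the_enat (halting_time (stop u) ys)) ys)))"
  note dec = measurable_stopped_decoder[OF g stop]
  have g': "(\<lambda>u. g' u ys) \<in> U \<rightarrow>\<^sub>M count_space (insert None (Some ` {1..M}))" for ys
  proof -
    have "(\<lambda>u. Some (g u (take (the_enat (halting_time (stop u) ys)) ys)))
        \<in> U \<rightarrow>\<^sub>M count_space (insert None (Some ` {1..M}))"
      by (rule measurable_compose[OF dec]) auto
    moreover have "{u \<in> space U. halting_time (stop u) ys = \<infinity>} \<in> sets U"
      using measurable_sets[OF measurable_halting_time[where ys = ys, OF stop], of "{\<infinity>}"]
      by (simp add: vimage_def Int_def conj_commute)
    ultimately show ?thesis
      unfolding g'_def by (intro measurable_If) auto
  qed
  have g'_pred: "(\<lambda>u. p (g' u ys)) \<in> U \<rightarrow>\<^sub>M count_space UNIV" for p :: "nat option \<Rightarrow> bool" and ys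
    by (rule measurable_compose[OF g']) simp
  have err_pred: "(\<lambda>u. g u (take (the_enat (halting_time (stop u) ys)) ys) \<noteq> w) \<in> U \<rightarrow>\<^sub>M count_space UNIV"
    for w ys
    by (rule measurable_compose[OF dec]) simp
  have g'_take: "g' u (take l ys) = (if halting_time (stop u) ys \<le> enat l
      then Some (g u (take (the_enat (halting_time (stop u) ys)) ys)) else None)" for u ys
    by (cases "halting_time (stop u) ys") (auto simp: g'_def halting_time_take min_def)
  have lK: "l \<le> K * l" using K by simp
  have erasure: "code_prob U P M f l (\<lambda>u w ys. g' u ys = None) \<le> 2 powr (- (\<gamma> * real l))"
    using late by (simp add: code_prob_take[OF lK M] g'_take not_le)
  have "code_prob U P M f l (\<lambda>u w ys. g' u ys \<noteq> Some w) - code_prob U P M f l (\<lambda>u w ys. g' u ys = None) =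
      code_prob U P M f l (\<lambda>u w ys. g' u ys \<noteq> Some w \<and> g' u ys \<noteq> None)"
    by (intro code_prob_diff U f M g'_pred) auto
  also have "\<dots> = code_prob U P M f (K * l) (\<lambda>u w ys. g' u (take l ys) \<noteq> Some w \<and> g' u (take l ys) \<noteq> None)"
    by (rule code_prob_take[OF lK M])
  also have "\<dots> \<le> code_prob U P M f (K * l)
      (\<lambda>u w ys. g u (take (the_enat (halting_time (stop u) ys)) ys) \<noteq> w)"
    by (intro code_prob_mono U f M g'_pred err_pred) (auto simp: g'_take split: if_splits)
  also note err
  finally have "code_prob U P M f l (\<lambda>u w ys. g' u ys \<noteq> Some w)
      - code_prob U P M f l (\<lambda>u w ys. g' u ys = None) \<le> \<epsilon>" .
  moreover have "2 powr (- (\<gamma> * real l)) < 1"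
    using \<gamma> l by (simp add: powr_less_one)
  ultimately have "ee_code P l M \<epsilon> (2 powr (- (\<gamma> * real l))) U f g'"
    using l M \<epsilon> U f g' erasure by (simp add: ee_code_def feedback_decoder_def)
  then show ?thesis by blast
qed

lemma aflf_achievable_imp_ee_achievable:
  fixes P :: "'x::finite \<Rightarrow> 'y::finite pmf"
  assumes "aflf_achievable P R \<gamma> K E" "0 < \<gamma>"
  shows "ee_achievable P R E \<gamma>"
  unfolding ee_achievable_def
proof (intro allI impI)
  fix \<delta> :: real assume \<delta>: "0 < \<delta>"
  then obtain l0 where l0: "\<And>l. l0 \<le> l \<Longrightarrow> \<exists>M \<epsilon> U f g stop. aflf_code P l M \<gamma> K \<epsilon> U f g stop \<and>
      2 powr (real l * R) \<le> real M \<and> \<epsilon> \<le> 2 powr (- (real l * (E - \<delta>)))"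
    using assms(1) unfolding aflf_achievable_def by meson
  have "\<exists>M \<epsilon> \<epsilon>\<^sub>x U f g. ee_code P l M \<epsilon> \<epsilon>\<^sub>x U f g \<and> 2 powr (real l * R) \<le> real M \<and>
      \<epsilon> \<le> 2 powr (- (real l * (E - \<delta>))) \<and> \<epsilon>\<^sub>x \<le> 2 powr (- (real l * (\<gamma> - \<delta>)))" if "l0 \<le> l" for l
  proof -
    have "2 powr (- (\<gamma> * real l)) \<le> 2 powr (- (real l * (\<gamma> - \<delta>)))"
      using \<delta> by (simp add: algebra_simps)
    then show ?thesis
      using l0[OF that] aflf_code_imp_ee_code[OF _ assms(2)] by meson
  qed
  then show "\<exists>l0. \<forall>l\<ge>l0. \<exists>M \<epsilon> \<epsilon>\<^sub>x U f g. ee_code P l M \<epsilon> \<epsilon>\<^sub>x U f g \<and> 2 powr (real l * R) \<le> real M \<and>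
      \<epsilon> \<le> 2 powr (- (real l * (E - \<delta>))) \<and> \<epsilon>\<^sub>x \<le> 2 powr (- (real l * (\<gamma> - \<delta>)))"
    by blast
qed

text \<open>An erasure exponent of zero only requires an erasure probability below one. Erasing with
  probability \<open>1 - \<eta>\<close>, decided by the common randomness alone, makes undetected errors arbitrarily
  rare.\<close>

lemma ee_achievable_zero:
  fixes P :: "'x::finite \<Rightarrow> 'y::finite pmf"
  assumes "0 \<le> E"
  shows "ee_achievable P R E 0"
  unfolding ee_achievable_def
proof (intro allI impI)
  fix \<delta> :: real assume \<delta>: "0 < \<delta>"
  have "\<exists>M \<epsilon> \<epsilon>\<^sub>x U f g. ee_code P l M \<epsilon> \<epsilon>\<^sub>x U f g \<and> 2 powr (real l * R) \<le> real M \<and>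
      \<epsilon> \<le> 2 powr (- (real l * (E - \<delta>))) \<and> \<epsilon>\<^sub>x \<le> 2 powr (- (real l * (0 - \<delta>)))" if l: "1 \<le> l" for l
  proof -
    define \<eta> where "\<eta> = min (1 / 2) (2 powr (- (real l * (E - \<delta>))))"
    define M where "M = nat \<lceil>2 powr (real l * R)\<rceil>"
    define U where "U = measure_pmf (map_pmf (\<lambda>b. if b then 1 else 0 :: real) (bernoulli_pmf \<eta>))"
    \<comment> \<open>The channel is ignored: the decoder announces message 1 unless it erases, so
      undetected errors are no likelier than not erasing.\<close>
    define f where "f = (\<lambda>(u::real) (w::nat) (ys::'y list). undefined :: 'x)"
    define g where "g = (\<lambda>(u::real) (ys::'y list). if u = 1 then Some (1::nat) else None)"
    have \<eta>: "0 < \<eta>" "\<eta> < 1" "\<eta> \<le> 2 powr (- (real l * (E - \<delta>)))"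
      by (auto simp: \<eta>_def)
    have "0 < \<lceil>2 powr (real l * R)\<rceil>" by simp
    then have M: "1 \<le> M" "2 powr (real l * R) \<le> real M"
      unfolding M_def by linarith+
    interpret U: prob_space U
      by (simp add: U_def measure_pmf.prob_space_axioms)
    have meas: "h \<in> U \<rightarrow>\<^sub>M count_space UNIV" for h :: "real \<Rightarrow> bool"
      by (simp add: U_def)
    have prob: "code_prob U P M f l (\<lambda>u w ys. h u) = measure_pmf.prob (bernoulli_pmf \<eta>) {b. h (if b then 1 else 0)}" for h
    proof -
      have "measure_pmf.prob (transmission P M (f u) l) {(w, ys). h u} = indicator {u. h u} u" for u
        by (cases "h u") auto
      then have "code_prob U P M f l (\<lambda>u w ys. h u) = measure U {u. h u}"
        by (simp add: code_prob_def U_def)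
      then show ?thesis by (simp add: U_def vimage_def)
    qed
    have erased: "{b. \<not> (if b then 1 else 0) = (1::real)} = {False}" "{b. (if b then 1 else 0) = (1::real)} = {True}"
      by auto
    have enc: "feedback_encoder U M f"
      by (simp add: feedback_encoder_def f_def)
    have dec: "feedback_decoder U (insert None (Some ` {1..M})) g"
      using M by (auto simp: feedback_decoder_def g_def U_def)
    have "code_prob U P M f l (\<lambda>u w ys. g u ys \<noteq> Some w) - code_prob U P M f l (\<lambda>u w ys. g u ys = None) =
        code_prob U P M f l (\<lambda>u w ys. g u ys \<noteq> Some w \<and> g u ys \<noteq> None)"
      by (intro code_prob_diff U.prob_space_axioms enc M meas) auto
    also have "\<dots> \<le> code_prob U P M f l (\<lambda>u w ys. u = 1)"
      by (intro code_prob_mono U.prob_space_axioms enc M meas) (auto simp: g_def split: if_splits)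
    also have "\<dots> = \<eta>"
      using \<eta> by (simp add: prob erased measure_pmf_single)
    finally have err: "code_prob U P M f l (\<lambda>u w ys. g u ys \<noteq> Some w)
        - code_prob U P M f l (\<lambda>u w ys. g u ys = None) \<le> \<eta>" .
    have "code_prob U P M f l (\<lambda>u w ys. g u ys = None) = code_prob U P M f l (\<lambda>u w ys. u \<noteq> 1)"
      unfolding g_def by (intro arg_cong[where f = "code_prob U P M f l"] ext) simp
    also have "\<dots> = 1 - \<eta>"
      using \<eta> by (simp add: prob erased measure_pmf_single)
    finally have "ee_code P l M \<eta> (1 - \<eta>) U f g"
      using l M(1) \<eta> U.prob_space_axioms enc dec err by (simp add: ee_code_def)
    moreover have "1 - \<eta> \<le> 2 powr (- (real l * (0 - \<delta>)))"
      using \<eta> \<delta> ge_one_powr_ge_zero[of 2 "real l * \<delta>"] by simp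
    ultimately show ?thesis
      using M(2) \<eta>(3) by blast
  qed
  then show "\<exists>l0. \<forall>l\<ge>l0. \<exists>M \<epsilon> \<epsilon>\<^sub>x U f g. ee_code P l M \<epsilon> \<epsilon>\<^sub>x U f g \<and> 2 powr (real l * R) \<le> real M \<and>
      \<epsilon> \<le> 2 powr (- (real l * (E - \<delta>))) \<and> \<epsilon>\<^sub>x \<le> 2 powr (- (real l * (0 - \<delta>)))"
    by blast
qed

lemma aflf_exponent_le_ee_exponent:
  fixes P :: "'x::finite \<Rightarrow> 'y::finite pmf"
  assumes "0 \<le> \<gamma>"
  shows "aflf_exponent P R \<gamma> K \<le> ee_exponent P R \<gamma>"
  unfolding aflf_exponent_def ee_exponent_def
proof (rule SUP_subset_mono)
  show "{E. 0 \<le> E \<and> aflf_achievable P R \<gamma> K E} \<subseteq> {E. 0 \<le> E \<and> ee_achievable P R E \<gamma>}"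
    using assms aflf_achievable_imp_ee_achievable[of P R \<gamma> K] ee_achievable_zero[of _ P R]
    by (cases "\<gamma> = 0") auto
qed simp

section \<open>The bound by the Haroutunian exponent\<close>

definition max_divergence :: "('x::finite \<Rightarrow> 'y::finite pmf) \<Rightarrow> ('x \<Rightarrow> 'y pmf) \<Rightarrow> ereal" where
  "max_divergence V P = (SUP Q. \<Sum>x\<in>UNIV. ereal (pmf Q x) * divergence (V x) (P x))"

lemma divergence_le_max_divergence: "divergence (V x) (P x) \<le> max_divergence V P"
proof -
  have "divergence (V x) (P x) = (\<Sum>x'\<in>UNIV. if x' = x then divergence (V x') (P x') else 0)"
    by simp
  also have "\<dots> = (\<Sum>x'\<in>UNIV. ereal (pmf (return_pmf x) x') * divergence (V x') (P x'))"
    by (intro sum.cong) (auto simp: one_ereal_def[symmetric] zero_ereal_def[symmetric])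
  also have "\<dots> \<le> max_divergence V P"
    unfolding max_divergence_def by (rule SUP_upper) simp
  finally show ?thesis .
qed

lemma max_divergence_finiteE:
  fixes V P :: "'x::finite \<Rightarrow> 'y::finite pmf"
  assumes "max_divergence V P < \<infinity>"
  obtains D where "max_divergence V P = ereal D" "\<And>x. set_pmf (V x) \<subseteq> set_pmf (P x)" "\<And>x. kl (V x) (P x) \<le> D * ln 2"
proof -
  have fin: "divergence (V x) (P x) < \<infinity>" for x
    using divergence_le_max_divergence assms by (rule le_less_trans)
  then have sub: "set_pmf (V x) \<subseteq> set_pmf (P x)" for x
    by (auto simp: divergence_eq_kl split: if_splits) (metis less_irrefl subsetD)
  then have div: "divergence (V x) (P x) = ereal (kl (V x) (P x) / ln 2)" for x
    by (simp add: divergence_eq_kl)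
  have le: "ereal (kl (V x) (P x) / ln 2) \<le> max_divergence V P" for x
    using divergence_le_max_divergence[of V x P] by (simp add: div)
  then obtain D where D: "max_divergence V P = ereal D"
    using assms by (cases "max_divergence V P") auto
  have "kl (V x) (P x) \<le> D * ln 2" for x
    using le[of x] by (simp add: D field_simps)
  then show ?thesis
    using that D sub by blast
qed

text \<open>For fixed \<open>u\<close>, stopping and then decoding is one function of the
  \<open>K * l\<close> outputs, so a bound for all deterministic block codes survives averaging over
  \<open>u\<close>.\<close>

lemma aflf_error_ge:
  fixes P :: "'x::finite \<Rightarrow> 'y::finite pmf"
  assumes code: "aflf_code P l M \<gamma> K \<epsilon> U f g stop"
    and c: "\<And>f dec. c \<le> measure_pmf.prob (transmission P M f (K * l)) {(w, ys). dec ys \<noteq> w}"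
  shows "c \<le> \<epsilon>"
proof -
  have U: "prob_space U" and f: "feedback_encoder U M f" and g: "feedback_decoder U {1..M} g" and M: "1 \<le> M"
    and stop: "\<And>ys. (\<lambda>u. stop u ys) \<in> U \<rightarrow>\<^sub>M count_space UNIV"
    and err: "code_prob U P M f (K * l)
      (\<lambda>u w ys. g u (take (the_enat (halting_time (stop u) ys)) ys) \<noteq> w) \<le> \<epsilon>"
    using code by (auto simp: aflf_code_def)
  interpret U: prob_space U by fact
  have "c \<le> code_prob U P M f (K * l) (\<lambda>u w ys. g u (take (the_enat (halting_time (stop u) ys)) ys) \<noteq> w)"
    unfolding code_prob_def
  proof (rule U.integral_ge_const)
    show "integrable U (\<lambda>u. measure_pmf.prob (transmission P M (f u) (K * l))
        {(w, ys). g u (take (the_enat (halting_time (stop u) ys)) ys) \<noteq> w})"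
      by (intro integrable_prob_transmission U f M measurable_compose[OF measurable_stopped_decoder[OF g stop]]) simp
  qed (use c in simp)
  then show ?thesis
    using err by simp
qed

lemma aflf_achievable_le_max_divergence:
  fixes P V V0 :: "'x::finite \<Rightarrow> 'y::finite pmf"
  assumes ach: "aflf_achievable P R \<gamma> K E" and K: "1 \<le> K"
    and V: "capacity V \<le> R / real K"
    and V0: "capacity V0 < R / real K" "max_divergence V0 P < \<infinity>"
  shows "ereal (E / real K) \<le> max_divergence V P"
proof (cases "max_divergence V P < \<infinity>")
  case True
  obtain D where D: "max_divergence V P = ereal D" "\<And>x. set_pmf (V x) \<subseteq> set_pmf (P x)" "\<And>x. kl (V x) (P x) \<le> D * ln 2"
    using max_divergence_finiteE[OF True] by metis
  obtain D0 where D0: "\<And>x. set_pmf (V0 x) \<subseteq> set_pmf (P x)" "\<And>x. kl (V0 x) (P x) \<le> D0 * ln 2"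
    using max_divergence_finiteE[OF V0(2)] by metis
  have "E \<le> real K * D + e" if e: "0 < e" for e
  proof -
    \<comment> \<open>One third pays for the slack in achievability, one for \<eta>, and one for the
      factor 1/2 in the error bound, once \<open>l * \<delta> \<ge> 1\<close>.\<close>
    define \<delta> where "\<delta> = e / 3"
    define \<eta> where "\<eta> = \<delta> * ln 2 / real K"
    have \<delta>: "0 < \<delta>" and \<eta>: "0 < \<eta>" using e K by (auto simp: \<delta>_def \<eta>_def)
    obtain n0 where n0: "\<And>n M f dec. n0 \<le> n \<Longrightarrow> 2 powr (real n * (R / real K)) \<le> real M \<Longrightarrow>
        exp (- (real n * (D * ln 2 + \<eta>))) / 2 \<le> measure_pmf.prob (transmission P M f n) {(w, ys). dec ys \<noteq> w}"
      using haroutunian_error_bound[OF D(2,3) V D0 V0(1) \<eta>] unfolding eventually_sequentially by meson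
    obtain l0 where l0: "\<And>l. l0 \<le> l \<Longrightarrow> \<exists>M \<epsilon> U f g stop. aflf_code P l M \<gamma> K \<epsilon> U f g stop \<and>
        2 powr (real l * R) \<le> real M \<and> \<epsilon> \<le> 2 powr (- (real l * (E - \<delta>)))"
      using ach \<delta> unfolding aflf_achievable_def by meson
    define l where "l = Max {n0, l0, 1, nat \<lceil>1 / \<delta>\<rceil>}"
    have l: "n0 \<le> l" "l0 \<le> l" "1 \<le> l" "nat \<lceil>1 / \<delta>\<rceil> \<le> l"
      unfolding l_def by (intro Max_ge; simp)+
    have "1 / \<delta> \<le> real l"
      using l(4) by linarith
    then have l\<delta>: "1 \<le> real l * \<delta>"
      using \<delta> by (simp add: field_simps)
    have n: "n0 \<le> K * l"
      using l(1) K by (metis le_trans mult_le_mono1 nat_mult_1)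
    obtain M \<epsilon> U f g stop where code: "aflf_code P l M \<gamma> K \<epsilon> U f g stop"
      and M: "2 powr (real l * R) \<le> real M" and \<epsilon>: "\<epsilon> \<le> 2 powr (- (real l * (E - \<delta>)))"
      using l0[OF l(2)] by blast
    have "2 powr (real (K * l) * (R / real K)) \<le> real M"
      using M K by (simp add: field_simps)
    then have "exp (- (real (K * l) * (D * ln 2 + \<eta>))) / 2 \<le> \<epsilon>"
      by (intro aflf_error_ge[OF code] n0[OF n])
    then have "exp (- (real (K * l) * (D * ln 2 + \<eta>))) / 2 \<le> 2 powr (- (real l * (E - \<delta>)))"
      using \<epsilon> by (rule order_trans)
    then have "exp (- (real (K * l) * (D * ln 2 + \<eta>)) - ln 2) \<le> exp (- (real l * (E - \<delta>)) * ln 2)"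
      by (simp add: exp_diff powr_def)
    then have "real l * (E - \<delta>) * ln 2 \<le> real (K * l) * (D * ln 2 + \<eta>) + ln 2"
      by simp
    also have "\<dots> = (real l * (real K * D + \<delta>) + 1) * ln 2"
      using K by (simp add: \<eta>_def field_simps)
    also have "\<dots> \<le> (real l * (real K * D + \<delta>) + real l * \<delta>) * ln 2"
      using l\<delta> by (intro mult_right_mono) auto
    also have "\<dots> = real l * (real K * D + 2 * \<delta>) * ln 2"
      by (simp add: algebra_simps)
    finally have "real l * (E - \<delta>) \<le> real l * (real K * D + 2 * \<delta>)"
      by (rule mult_right_le_imp_le) simp
    then have "E - \<delta> \<le> real K * D + 2 * \<delta>"
      using l(3) by simp
    then show ?thesis
      by (simp add: \<delta>_def)
  qed
  then have "E \<le> real K * D"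
    by (rule field_le_epsilon)
  then show ?thesis
    using K by (simp add: D(1) field_simps)
qed simp

lemma aflf_exponent_le_haroutunian_exponent:
  fixes P :: "'x::finite \<Rightarrow> 'y::finite pmf"
  assumes K: "1 \<le> K" and ne: "R / real K \<noteq> finiteness_rate P"
  shows "aflf_exponent P R \<gamma> K \<le> ereal (real K) * haroutunian_exponent P (R / real K)"
proof (cases "haroutunian_exponent P (R / real K) < \<infinity>")
  case True
  have H: "haroutunian_exponent P r = (INF V\<in>{V. capacity V \<le> r}. max_divergence V P)" for r
    by (simp add: haroutunian_exponent_def max_divergence_def)
  let ?S = "{r. haroutunian_exponent P r < \<infinity>}"
  \<comment> \<open>The real infimum in \<open>finiteness_rate\<close> is a lower bound only if the
    set is bounded below; nonnegativity of capacity ensures this.\<close>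
  have "0 \<le> r" if r: "r \<in> ?S" for r
  proof -
    obtain V :: "'x \<Rightarrow> 'y pmf" where "capacity V \<le> r"
      using r unfolding H mem_Collect_eq INF_less_iff by blast
    then show ?thesis using capacity_nonneg[of V] by simp
  qed
  then have "bdd_below ?S" by (rule bdd_belowI)
  then have "finiteness_rate P \<le> R / real K"
    unfolding finiteness_rate_def using True by (intro cInf_lower) auto
  \<comment> \<open>Strictness leaves a smaller rate at which the exponent is still finite, and a
    channel witnessing this is the required \<open>V0\<close>.\<close>
  with ne have "Inf ?S < R / real K"
    by (simp add: finiteness_rate_def)
  then obtain r where "r \<in> ?S" "r < R / real K"
    using True by (metis cInf_lessD empty_iff mem_Collect_eq)
  then obtain V0 where V0: "capacity V0 < R / real K" "max_divergence V0 P < \<infinity>"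
    unfolding H mem_Collect_eq INF_less_iff by (auto intro: le_less_trans)
  have "ereal E \<le> ereal (real K) * haroutunian_exponent P (R / real K)" if "aflf_achievable P R \<gamma> K E" for E
  proof -
    have "ereal (E / real K) \<le> haroutunian_exponent P (R / real K)"
      unfolding H by (intro INF_greatest) (use aflf_achievable_le_max_divergence[OF that K _ V0] in auto)
    then have "ereal (real K) * ereal (E / real K) \<le> ereal (real K) * haroutunian_exponent P (R / real K)"
      by (intro ereal_mult_left_mono) auto
    then show ?thesis
      using K by simp
  qed
  then show ?thesis
    unfolding aflf_exponent_def by (intro SUP_least) auto
next
  case False
  \<comment> \<open>Since \<open>K\<close> is positive, the product is \<infinity> and not the
    default value of \<open>0 * \<infinity>\<close>.\<close>
  then show ?thesis
    using K by simp
qed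

theorem proposition2:
  fixes P :: "'x::finite \<Rightarrow> 'y::finite pmf" and R \<gamma> :: real and K :: nat
  assumes "0 \<le> R" and "R < capacity P" and "0 \<le> \<gamma>" and "1 \<le> K"
  shows "aflf_exponent P R \<gamma> K \<le> ee_exponent P R \<gamma> \<and>
    (R / real K \<noteq> finiteness_rate P \<longrightarrow>
      aflf_exponent P R \<gamma> K
        \<le> min (ee_exponent P R \<gamma>) (ereal (real K) * haroutunian_exponent P (R / real K)))"
  using assms aflf_exponent_le_ee_exponent aflf_exponent_le_haroutunian_exponent by auto

end
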